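(* For any $A_0\in\mathfrak{gl}_n(\mathbb{R})$, the following conditions are equivalent: (i) $\mu_{A_0}$ is an algebraic soliton. (ii) $A_0$ is either a normal matrix, or a nilpotent matrix such that $[A_0,[A_0,A_0^t]]=cA_0$ for some $c\in\mathbb{R}$. Moreover, the evolution of the bracket flow $\mu_{A(t)}$ starting at $\mu_{A_0}$ is respectively given by $$A(t)=\left(2\operatorname{tr}(S(A_0)^2)t+1\right)^{-1/2}A_0\quad\text{(normal case)}\qquad\text{or}\qquad A(t)=\left((\|A_0\|^2-c)t+1\right)^{-1/2}A_0\quad\text{(nilpotent case)}.$$
   Context: Let $n\ge1$ and equip $\mathbb{R}^{n+1}=\mathbb{R}e_0\oplus\mathbb{R}^n$ with the canonical inner product $\langle\cdot,\cdot\rangle$ and canonical basis $e_0,e_1,\dots,e_n$. For $A\in\mathfrak{gl}_n(\mathbb{R})$, $\mu_A$ is the Lie bracket on $\mathbb{R}^{n+1}$ given by $\mu_A(e_0,e_i)=Ae_i$ and $\mu_A(e_i,e_j)=0$ for $i,j\ge1$, where $A$ acts on $\mathbb{R}^n=\langle e_1,\dots,e_n\rangle$. $G_{\mu_A}$ is the simply connected Lie group with Lie algebra $(\mathbb{R}^{n+1},\mu_A)$ and $g_{\mu_A}$ is the left-invariant Riemannian metric on it equal to $\langle\cdot,\cdot\rangle$ at the identity. $\mu_A$ is called an algebraic soliton if the Ricci operator of $(G_{\mu_A},g_{\mu_A})$ has the form $aI+D$ with $a\in\mathbb{R}$ and $D$ a derivation of $(\mathbb{R}^{n+1},\mu_A)$.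 The bracket flow starting at $\mu_{A_0}$ is $\mu_{A(t)}$, where $A(t)$ is the solution of $$\tfrac{d}{dt}A=-\operatorname{tr}(S(A)^2)A+\tfrac12[A,[A,A^t]]-\tfrac12\operatorname{tr}(A)[A,A^t],\quad A(0)=A_0,\qquad S(A)=\tfrac12(A+A^t).$$ Here $\|A\|^2=\operatorname{tr}(AA^t)$. *)

theory Defs
  imports "HOL-Analysis.Analysis"
begin

section \<open>Matrices\<close>

text \<open>Powers, exponentials and nilpotency refer to the matrix product: on the type
  \<^typ>\<open>real^'n^'n\<close> the overloaded \<open>*\<close> and \<open>^\<close> act componentwise.\<close>

definition matrix_power :: "real^'n^'n \<Rightarrow> nat \<Rightarrow> real^'n^'n" where
  "matrix_power A k = (((**) A) ^^ k) (mat 1)"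

definition matrix_exp :: "real^'n^'n \<Rightarrow> real^'n^'n" where
  "matrix_exp A = (\<Sum>k. (1 / fact k) *\<^sub>R matrix_power A k)"

definition nilpotent_matrix :: "real^'n^'n \<Rightarrow> bool" where
  "nilpotent_matrix A \<longleftrightarrow> (\<exists>k. matrix_power A k = 0)"

definition normal_matrix :: "real^'n^'n \<Rightarrow> bool" where
  "normal_matrix A \<longleftrightarrow> A ** transpose A = transpose A ** A"

definition commutator :: "real^'n^'n \<Rightarrow> real^'n^'n \<Rightarrow> real^'n^'n" where
  "commutator A B = A ** B - B ** A"

definition sym_part :: "real^'n^'n \<Rightarrow> real^'n^'n" where
  "sym_part A = (1/2) *\<^sub>R (A + transpose A)"

section \<open>Lie groups and Riemannian metrics in a global chart\<close>

text \<open>All manifolds here are a Euclidean space \<^typ>\<open>'a\<close> with its identity chart. Vector fields are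
  functions \<^typ>\<open>'a \<Rightarrow> 'a\<close>, and a metric \<open>g\<close> assigns to each point \<open>p\<close> the inner product \<open>g p\<close>
  on the tangent space \<^typ>\<open>'a\<close> at \<open>p\<close>.\<close>

definition field_bracket :: "('a::euclidean_space \<Rightarrow> 'a) \<Rightarrow> ('a \<Rightarrow> 'a) \<Rightarrow> 'a \<Rightarrow> 'a" where
  "field_bracket X Y p =
     frechet_derivative Y (at p) (X p) - frechet_derivative X (at p) (Y p)"

definition left_invariant_field ::
  "('a::euclidean_space \<Rightarrow> 'a \<Rightarrow> 'a) \<Rightarrow> 'a \<Rightarrow> 'a \<Rightarrow> 'a \<Rightarrow> 'a" where
  "left_invariant_field mul e v p = frechet_derivative (mul p) (at e) v"

text \<open>The left-invariant metric extending the Euclidean inner product at the identity: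
  the pullback at \<open>p\<close> of the inner product under left translation by the inverse of \<open>p\<close>.\<close>

definition left_invariant_metric ::
  "('a::euclidean_space \<Rightarrow> 'a \<Rightarrow> 'a) \<Rightarrow> ('a \<Rightarrow> 'a) \<Rightarrow> 'a \<Rightarrow> 'a \<Rightarrow> 'a \<Rightarrow> real" where
  "left_invariant_metric mul iv p u v =
     frechet_derivative (mul (iv p)) (at p) u \<bullet> frechet_derivative (mul (iv p)) (at p) v"

text \<open>The Christoffel symbols, as a bilinear map of the tangent vectors \<open>u\<close>, \<open>v\<close>; nondegeneracy of
  \<open>g p\<close> makes the described vector unique.\<close>

definition christoffel :: "('a::euclidean_space \<Rightarrow> 'a \<Rightarrow> 'a \<Rightarrow> real) \<Rightarrow> 'a \<Rightarrow> 'a \<Rightarrow> 'a \<Rightarrow> 'a" where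
  "christoffel g p u v = (THE w. \<forall>z. 2 * g p w z =
      frechet_derivative (\<lambda>q. g q v z) (at p) u
    + frechet_derivative (\<lambda>q. g q u z) (at p) v
    - frechet_derivative (\<lambda>q. g q u v) (at p) z)"

definition levi_civita ::
  "('a::euclidean_space \<Rightarrow> 'a \<Rightarrow> 'a \<Rightarrow> real) \<Rightarrow> ('a \<Rightarrow> 'a) \<Rightarrow> ('a \<Rightarrow> 'a) \<Rightarrow> 'a \<Rightarrow> 'a" where
  "levi_civita g X Y p = frechet_derivative Y (at p) (X p) + christoffel g p (X p) (Y p)"

definition curvature_field ::
  "('a::euclidean_space \<Rightarrow> 'a \<Rightarrow> 'a \<Rightarrow> real) \<Rightarrow> ('a \<Rightarrow> 'a) \<Rightarrow> ('a \<Rightarrow> 'a) \<Rightarrow> ('a \<Rightarrow> 'a) \<Rightarrow> 'a \<Rightarrow> 'a" where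
  "curvature_field g X Y Z p =
     levi_civita g X (levi_civita g Y Z) p - levi_civita g Y (levi_civita g X Z) p
     - levi_civita g (field_bracket X Y) Z p"

text \<open>By tensoriality, the value on tangent vectors at \<open>p\<close> may be computed on the fields
  that are constant in the chart.\<close>

definition curvature_tensor ::
  "('a::euclidean_space \<Rightarrow> 'a \<Rightarrow> 'a \<Rightarrow> real) \<Rightarrow> 'a \<Rightarrow> 'a \<Rightarrow> 'a \<Rightarrow> 'a \<Rightarrow> 'a" where
  "curvature_tensor g p u v w = curvature_field g (\<lambda>_. u) (\<lambda>_. v) (\<lambda>_. w) p"

text \<open>The trace of \<open>w \<mapsto> R(w,u)v\<close>; as a trace of an endomorphism it does not depend on the basis,
  which need not be orthonormal for \<open>g p\<close>.\<close>

definition ricci_tensor :: "('a::euclidean_space \<Rightarrow> 'a \<Rightarrow> 'a \<Rightarrow> real) \<Rightarrow> 'a \<Rightarrow> 'a \<Rightarrow> 'a \<Rightarrow> real" where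
  "ricci_tensor g p u v = (\<Sum>b\<in>Basis. curvature_tensor g p b u v \<bullet> b)"

definition ricci_operator :: "('a::euclidean_space \<Rightarrow> 'a \<Rightarrow> 'a \<Rightarrow> real) \<Rightarrow> 'a \<Rightarrow> 'a \<Rightarrow> 'a" where
  "ricci_operator g p u = (THE w. \<forall>v. g p w v = ricci_tensor g p u v)"

section \<open>The Lie algebra of a matrix and its simply connected Lie group\<close>

text \<open>\<open>\<real> \<times> \<real>\<^sup>n\<close> stands for \<open>\<real>e\<^sub>0 \<oplus> \<real>\<^sup>n\<close>, with \<open>e\<^sub>0 = (1, 0)\<close>.
  The bilinear alternating extension of \<open>\<mu>(e\<^sub>0, y) = Ay\<close>, \<open>\<mu>(x, y) = 0\<close>:\<close>

definition mu :: "real^'n^'n \<Rightarrow> real \<times> (real^'n) \<Rightarrow> real \<times> (real^'n) \<Rightarrow> real \<times> (real^'n)" where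
  "mu A u v = (0, fst u *\<^sub>R (A *v snd v) - fst v *\<^sub>R (A *v snd u))"

definition derivation :: "('a::real_vector \<Rightarrow> 'a \<Rightarrow> 'a) \<Rightarrow> ('a \<Rightarrow> 'a) \<Rightarrow> bool" where
  "derivation br D \<longleftrightarrow> linear D \<and> (\<forall>x y. D (br x y) = br (D x) y + br x (D y))"

text \<open>The semidirect product in which \<open>s \<in> \<real>\<close> acts on \<open>\<real>\<^sup>n\<close> by \<open>exp (sA)\<close>. Its underlying manifold
  is a vector space, so it is simply connected, and its Lie algebra is \<open>\<mu>\<^sub>A\<close> (see the
  lemmas at the end of this theory). Simply connected Lie groups are determined by their Lie
  algebra up to isomorphism.\<close>

definition grp_mult ::
  "real^'n^'n \<Rightarrow> real \<times> (real^'n) \<Rightarrow> real \<times> (real^'n) \<Rightarrow> real \<times> (real^'n)" where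
  "grp_mult A p q = (fst p + fst q, snd p + matrix_exp (fst p *\<^sub>R A) *v snd q)"

definition grp_inv :: "real^'n^'n \<Rightarrow> real \<times> (real^'n) \<Rightarrow> real \<times> (real^'n)" where
  "grp_inv A p = (- fst p, - (matrix_exp (- fst p *\<^sub>R A) *v snd p))"

definition grp_metric ::
  "real^'n^'n \<Rightarrow> real \<times> (real^'n) \<Rightarrow> real \<times> (real^'n) \<Rightarrow> real \<times> (real^'n) \<Rightarrow> real" where
  "grp_metric A = left_invariant_metric (grp_mult A) (grp_inv A)"

text \<open>The Ricci operator is taken at the identity \<open>0\<close>, as an endomorphism of the Lie algebra.\<close>

definition algebraic_soliton :: "real^'n^'n \<Rightarrow> bool" where
  "algebraic_soliton A \<longleftrightarrow>
     (\<exists>a D. derivation (mu A) D \<and> (\<forall>v. ricci_operator (grp_metric A) 0 v = a *\<^sub>R v + D v))"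

section \<open>The bracket flow\<close>

definition bracket_flow_rhs :: "real^'n^'n \<Rightarrow> real^'n^'n" where
  "bracket_flow_rhs A =
     - trace (sym_part A ** sym_part A) *\<^sub>R A
     + (1/2) *\<^sub>R commutator A (commutator A (transpose A))
     - (1/2 * trace A) *\<^sub>R commutator A (transpose A)"

definition bracket_flow_solution ::
  "real^'n^'n \<Rightarrow> real set \<Rightarrow> (real \<Rightarrow> real^'n^'n) \<Rightarrow> bool" where
  "bracket_flow_solution A0 T A \<longleftrightarrow>
     is_interval T \<and> 0 \<in> T \<and> A 0 = A0 \<and>
     (\<forall>t\<in>T. (A has_vector_derivative bracket_flow_rhs (A t)) (at t within T))"

text \<open>\<open>A\<close> is the solution starting at \<open>A0\<close> on the interval \<open>T\<close>: it is a solution, and any other solution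
  agrees with it on the common domain.\<close>

definition bracket_flow_on ::
  "real^'n^'n \<Rightarrow> real set \<Rightarrow> (real \<Rightarrow> real^'n^'n) \<Rightarrow> bool" where
  "bracket_flow_on A0 T A \<longleftrightarrow>
     bracket_flow_solution A0 T A \<and>
     (\<forall>T' B. bracket_flow_solution A0 T' B \<longrightarrow> (\<forall>t\<in>T \<inter> T'. B t = A t))"

definition maximal_bracket_flow ::
  "real^'n^'n \<Rightarrow> real set \<Rightarrow> (real \<Rightarrow> real^'n^'n) \<Rightarrow> bool" where
  "maximal_bracket_flow A0 T A \<longleftrightarrow>
     bracket_flow_on A0 T A \<and> (\<forall>T' B. bracket_flow_solution A0 T' B \<longrightarrow> T' \<subseteq> T)"

section \<open>The semidirect product is a Lie group with Lie algebra \<open>\<mu>\<^sub>A\<close>\<close>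

lemma matrix_power_0 [simp]: "matrix_power A 0 = mat 1"
  by (simp add: matrix_power_def)

lemma matrix_power_Suc: "matrix_power A (Suc k) = A ** matrix_power A k"
  by (simp add: matrix_power_def)

lemma matrix_power_Suc_right: "matrix_power A (Suc k) = matrix_power A k ** A"
  by (induction k) (simp_all add: matrix_power_Suc matrix_mul_assoc)

lemma matrix_scaleR_left: "(c *\<^sub>R A) ** B = c *\<^sub>R (A ** B :: real^'n^'n)"
  by (simp add: matrix_matrix_mult_def vec_eq_iff sum_distrib_left mult.assoc)

lemma matrix_scaleR_right: "A ** (c *\<^sub>R B) = c *\<^sub>R (A ** B :: real^'n^'n)"
  by (simp add: matrix_matrix_mult_def vec_eq_iff sum_distrib_left mult.left_commute)

lemma matrix_power_scaleR: "matrix_power (s *\<^sub>R A) k = s ^ k *\<^sub>R matrix_power A k"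
  by (induction k) (simp_all add: matrix_power_Suc matrix_scaleR_left matrix_scaleR_right)

lemma matrix_power_entry_bound:
  fixes A :: "real^'n^'n"
  shows "\<bar>matrix_power A k $ i $ j\<bar> \<le> (\<Sum>i\<in>UNIV. \<Sum>j\<in>UNIV. \<bar>A $ i $ j\<bar>) ^ k"
proof (induction k arbitrary: i j)
  case 0
  then show ?case by (simp add: mat_def)
next
  case (Suc k)
  let ?M = "\<Sum>i\<in>UNIV. \<Sum>j\<in>UNIV. \<bar>A $ i $ j\<bar>"
  have M0: "0 \<le> ?M" by (intro sum_nonneg) auto
  have "\<bar>matrix_power A (Suc k) $ i $ j\<bar> \<le> (\<Sum>l\<in>UNIV. \<bar>A $ i $ l\<bar> * \<bar>matrix_power A k $ l $ j\<bar>)"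
    by (simp add: matrix_power_Suc matrix_matrix_mult_def flip: abs_mult)
  also have "\<dots> \<le> (\<Sum>l\<in>UNIV. \<bar>A $ i $ l\<bar> * ?M ^ k)"
    by (intro sum_mono mult_left_mono Suc) auto
  also have "\<dots> = (\<Sum>l\<in>UNIV. \<bar>A $ i $ l\<bar>) * ?M ^ k"
    by (simp add: sum_distrib_right)
  also have "\<dots> \<le> ?M * ?M ^ k"
    using M0 by (intro mult_right_mono member_le_sum[where f="\<lambda>i. \<Sum>l\<in>UNIV. \<bar>A $ i $ l\<bar>"])
      (auto intro: sum_nonneg)
  finally show ?case by simp
qed

lemma summable_exp_entry:
  fixes A :: "real^'n^'n"
  shows "summable (\<lambda>k. (matrix_power A k $ i $ j / fact k) * s ^ k)"
proof -
  let ?M = "\<Sum>i\<in>UNIV. \<Sum>j\<in>UNIV. \<bar>A $ i $ j\<bar>"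
  have M0: "0 \<le> ?M" by (intro sum_nonneg) auto
  show ?thesis
  proof (rule summable_comparison_test'[where N=0])
    show "summable (\<lambda>k. (?M * \<bar>s\<bar>) ^ k / fact k)"
      using summable_exp[of "?M * \<bar>s\<bar>"] by (simp add: divide_inverse mult.commute)
    show "norm ((matrix_power A k $ i $ j / fact k) * s ^ k) \<le> (?M * \<bar>s\<bar>) ^ k / fact k" for k
      using mult_right_mono[OF matrix_power_entry_bound[of A k i j], of "\<bar>s\<bar> ^ k / fact k"]
      by (simp add: abs_mult power_mult_distrib power_abs)
  qed
qed

lemma sums_vec_componentwise:
  fixes f :: "nat \<Rightarrow> real^'n^'m"
  assumes "\<And>i j. (\<lambda>k. f k $ i $ j) sums (S $ i $ j)"
  shows "f sums S"
  using assms unfolding sums_def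
  by (intro vec_tendstoI) simp

lemma matrix_exp_scaleR_entry:
  fixes A :: "real^'n^'n"
  shows "matrix_exp (s *\<^sub>R A) $ i $ j = (\<Sum>k. (matrix_power A k $ i $ j / fact k) * s ^ k)"
proof -
  define S :: "real^'n^'n" where
    "S = (\<chi> i j. \<Sum>k. (matrix_power A k $ i $ j / fact k) * s ^ k)"
  have "(\<lambda>k. (1 / fact k) *\<^sub>R matrix_power (s *\<^sub>R A) k) sums S"
    by (rule sums_vec_componentwise)
      (use summable_sums[OF summable_exp_entry[of A _ _ s]] in
        \<open>simp add: S_def matrix_power_scaleR mult.commute\<close>)
  then have "matrix_exp (s *\<^sub>R A) = S"
    unfolding matrix_exp_def by (rule sums_unique[symmetric])
  then show ?thesis by (simp add: S_def)
qed

lemma matrix_exp_entry_deriv: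
  fixes A :: "real^'n^'n"
  shows "((\<lambda>s. matrix_exp (s *\<^sub>R A) $ i $ j) has_real_derivative
           (\<Sum>k. (matrix_power A (Suc k) $ i $ j / fact k) * s ^ k)) (at s)"
proof -
  have "diffs (\<lambda>k. matrix_power A k $ i $ j / fact k) = (\<lambda>k. matrix_power A (Suc k) $ i $ j / fact k)"
    by (simp add: diffs_def fun_eq_iff del: of_nat_Suc)
  then show ?thesis
    using termdiffs_strong_converges_everywhere[OF summable_exp_entry[of A i j], of s]
    by (simp add: matrix_exp_scaleR_entry)
qed

lemma exp_left_entry:
  fixes A :: "real^'n^'n"
  shows "(\<Sum>k. (matrix_power A (Suc k) $ i $ j / fact k) * s ^ k) = (A ** matrix_exp (s *\<^sub>R A)) $ i $ j"
proof -
  have "(\<lambda>k. \<Sum>l\<in>UNIV. A $ i $ l * ((matrix_power A k $ l $ j / fact k) * s ^ k)) sums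
      (\<Sum>l\<in>UNIV. A $ i $ l * matrix_exp (s *\<^sub>R A) $ l $ j)"
    by (intro sums_sum sums_mult)
      (simp only: matrix_exp_scaleR_entry summable_sums[OF summable_exp_entry])
  then show ?thesis
    by (simp add: matrix_power_Suc matrix_matrix_mult_def sum_divide_distrib sum_distrib_right
        sums_iff mult.assoc)
qed

lemma exp_right_entry:
  fixes A :: "real^'n^'n"
  shows "(\<Sum>k. (matrix_power A (Suc k) $ i $ j / fact k) * s ^ k) = (matrix_exp (s *\<^sub>R A) ** A) $ i $ j"
proof -
  have "(\<lambda>k. \<Sum>l\<in>UNIV. ((matrix_power A k $ i $ l / fact k) * s ^ k) * A $ l $ j) sums
      (\<Sum>l\<in>UNIV. matrix_exp (s *\<^sub>R A) $ i $ l * A $ l $ j)"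
    by (intro sums_sum sums_mult2)
      (simp only: matrix_exp_scaleR_entry summable_sums[OF summable_exp_entry])
  moreover have "(matrix_power A (Suc k) $ i $ j / fact k) * s ^ k
      = (\<Sum>l\<in>UNIV. ((matrix_power A k $ i $ l / fact k) * s ^ k) * A $ l $ j)" for k
    unfolding matrix_power_Suc_right
    by (simp add: matrix_matrix_mult_def sum_divide_distrib sum_distrib_right mult.assoc)
      (simp add: mult.commute)
  ultimately show ?thesis
    by (simp add: sums_iff) (simp add: matrix_matrix_mult_def)
qed

lemma matrix_exp_commute: "matrix_exp (s *\<^sub>R A) ** A = A ** matrix_exp (s *\<^sub>R A)"
  by (simp add: vec_eq_iff flip: exp_left_entry exp_right_entry)

lemma has_vector_derivative_matrix_exp:
  fixes A :: "real^'n^'n"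
  shows "((\<lambda>s. matrix_exp (s *\<^sub>R A)) has_vector_derivative A ** matrix_exp (s *\<^sub>R A)) (at s)"
proof -
  have "((\<lambda>s. matrix_exp (s *\<^sub>R A) $ i $ j) has_derivative
      (\<lambda>h. (h *\<^sub>R (A ** matrix_exp (s *\<^sub>R A))) $ i $ j)) (at s)" for i j
    using matrix_exp_entry_deriv[of A i j s]
    unfolding exp_left_entry has_field_derivative_def
    by (rule has_derivative_eq_rhs) (simp add: fun_eq_iff)
  then show ?thesis
    unfolding has_vector_derivative_def
    by (subst has_derivative_componentwise_within)
      (auto simp: Basis_vec_def inner_axis)
qed

lemma bounded_bilinear_matrix_mult:
  "bounded_bilinear ((**) :: real^'n^'n \<Rightarrow> real^'n^'n \<Rightarrow> real^'n^'n)"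
  unfolding bilinear_conv_bounded_bilinear[symmetric] bilinear_def
  by (intro conjI allI linearI matrix_scaleR_left matrix_scaleR_right)
    (simp_all add: matrix_matrix_mult_def vec_eq_iff distrib_left distrib_right sum.distrib)

lemma bounded_bilinear_matrix_vector_mult:
  "bounded_bilinear ((*v) :: real^'n^'n \<Rightarrow> real^'n \<Rightarrow> real^'n)"
  unfolding bilinear_conv_bounded_bilinear[symmetric] bilinear_def
  by (intro conjI allI linearI)
    (simp_all add: matrix_vector_mult_def vec_eq_iff distrib_left distrib_right sum.distrib
      sum_distrib_left mult.assoc mult.left_commute)

lemma matrix_exp_0 [simp]: "matrix_exp (0 :: real^'n^'n) = mat 1"
proof -
  have "matrix_power (0 :: real^'n^'n) k = (if k = 0 then mat 1 else 0)" for k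
    by (cases k) (simp_all add: matrix_power_Suc)
  then have "(\<lambda>k. (1 / fact k) *\<^sub>R matrix_power (0 :: real^'n^'n) k) = (\<lambda>k. if k = 0 then mat 1 else 0)"
    by auto
  then show ?thesis
    unfolding matrix_exp_def using sums_single[of 0 "\<lambda>_. mat 1 :: real^'n^'n"] by (simp add: sums_iff)
qed

lemma matrix_exp_add_scaleR:
  fixes A :: "real^'n^'n"
  shows "matrix_exp ((s + t) *\<^sub>R A) = matrix_exp (s *\<^sub>R A) ** matrix_exp (t *\<^sub>R A)"
proof -
  have const: "matrix_exp (- s *\<^sub>R A) ** matrix_exp ((s + t) *\<^sub>R A) = matrix_exp (t *\<^sub>R A)" for s t
  proof -
    have d1: "((\<lambda>s. matrix_exp (- s *\<^sub>R A)) has_vector_derivative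
        - (matrix_exp (- s *\<^sub>R A) ** A)) (at s)" for s
    proof -
      have "(uminus has_vector_derivative (-1::real)) (at s)"
        by (auto intro!: derivative_eq_intros)
      from vector_diff_chain_at[OF this has_vector_derivative_matrix_exp[of A "- s"]]
      show ?thesis using matrix_exp_commute[of "- s" A] by (simp add: o_def)
    qed
    have d2: "((\<lambda>s. matrix_exp ((s + t) *\<^sub>R A)) has_vector_derivative
        A ** matrix_exp ((s + t) *\<^sub>R A)) (at s)" for s
    proof -
      have "((\<lambda>s. s + t) has_vector_derivative 1) (at s)"
        by (auto intro!: derivative_eq_intros)
      from vector_diff_chain_at[OF this has_vector_derivative_matrix_exp[of A "s + t"]]
      show ?thesis by (simp add: o_def)
    qed
    have neg: "(- X) ** Y = - (X ** Y)" for X Y :: "real^'n^'n"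
      by (simp add: matrix_matrix_mult_def vec_eq_iff sum_negf)
    have "((\<lambda>s. matrix_exp (- s *\<^sub>R A) ** matrix_exp ((s + t) *\<^sub>R A)) has_vector_derivative 0)
        (at s)" for s
      using bounded_bilinear.has_vector_derivative[OF bounded_bilinear_matrix_mult d1 d2, of s]
      by (simp add: neg matrix_mul_assoc)
    then obtain c where "\<And>s. matrix_exp (- s *\<^sub>R A) ** matrix_exp ((s + t) *\<^sub>R A) = c"
      using has_vector_derivative_zero_constant[of UNIV
          "\<lambda>s. matrix_exp (- s *\<^sub>R A) ** matrix_exp ((s + t) *\<^sub>R A)"] by auto
    from this[of s] this[of 0] show ?thesis by simp
  qed
  have "matrix_exp (s *\<^sub>R A) ** matrix_exp (- s *\<^sub>R A) = mat 1"
    using const[of "- s" 0] by simp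
  then show ?thesis
    using const[of s t] by (metis matrix_mul_assoc matrix_mul_lid)
qed

lemma grp_mult_assoc: "grp_mult A (grp_mult A p q) r = grp_mult A p (grp_mult A q r)"
  by (simp add: grp_mult_def matrix_exp_add_scaleR matrix_vector_mul_assoc
      matrix_vector_right_distrib)

lemma grp_mult_0_left: "grp_mult A 0 p = p"
  by (simp add: grp_mult_def)

lemma grp_mult_0_right: "grp_mult A p 0 = p"
  by (simp add: grp_mult_def)

lemma grp_mult_inv_left: "grp_mult A (grp_inv A p) p = 0"
  by (simp add: grp_mult_def grp_inv_def prod_eq_iff)

lemma grp_mult_inv_right: "grp_mult A p (grp_inv A p) = 0"
proof -
  have "matrix_exp (fst p *\<^sub>R A) ** matrix_exp (- fst p *\<^sub>R A) = mat 1"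
    using matrix_exp_add_scaleR[of "fst p" "- fst p" A] by simp
  then show ?thesis
    using bounded_bilinear.minus_right[OF bounded_bilinear_matrix_vector_mult,
        of "matrix_exp (fst p *\<^sub>R A)"]
    by (simp add: grp_mult_def grp_inv_def prod_eq_iff matrix_vector_mul_assoc)
qed

lemma left_invariant_field_grp:
  fixes A :: "real^'n^'n"
  shows "left_invariant_field (grp_mult A) 0 v p = (fst v, matrix_exp (fst p *\<^sub>R A) *v snd v)"
proof -
  have "(grp_mult A p has_derivative (\<lambda>v. (fst v, matrix_exp (fst p *\<^sub>R A) *v snd v))) (at 0)"
    unfolding grp_mult_def
    by (auto intro!: derivative_eq_intros
        bounded_linear.has_derivative[OF matrix_vector_mul_bounded_linear])
  then show ?thesis
    by (simp add: left_invariant_field_def frechet_derivative_at[symmetric])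
qed

lemma lie_algebra_grp:
  fixes A :: "real^'n^'n"
  shows "field_bracket (left_invariant_field (grp_mult A) 0 u) (left_invariant_field (grp_mult A) 0 v)
    = left_invariant_field (grp_mult A) 0 (mu A u v)"
proof
  fix p :: "real \<times> (real^'n)"
  let ?E = "\<lambda>s. matrix_exp (s *\<^sub>R A)"
  have D: "(left_invariant_field (grp_mult A) 0 v has_derivative
      (\<lambda>w. (0, fst w *\<^sub>R ((A ** ?E (fst p)) *v snd v)))) (at p)" for v
  proof -
    have "((\<lambda>p. ?E (fst p)) has_derivative (\<lambda>w. fst w *\<^sub>R (A ** ?E (fst p)))) (at p)"
      using has_derivative_compose[OF has_derivative_fst[OF has_derivative_ident]
          has_vector_derivative_matrix_exp[of A "fst p", unfolded has_vector_derivative_def]]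
      by simp
    from bounded_linear.has_derivative[OF
        bounded_bilinear.bounded_linear_left[OF bounded_bilinear_matrix_vector_mult] this, of "snd v"]
    show ?thesis
      unfolding left_invariant_field_grp
      by (auto intro!: derivative_eq_intros simp: scaleR_matrix_vector_assoc)
  qed
  show "field_bracket (left_invariant_field (grp_mult A) 0 u)
      (left_invariant_field (grp_mult A) 0 v) p = left_invariant_field (grp_mult A) 0 (mu A u v) p"
    unfolding field_bracket_def frechet_derivative_at[OF D, symmetric]
    unfolding left_invariant_field_grp
    by (simp add: mu_def matrix_vector_mult_diff_distrib matrix_vector_mult_scaleR
        matrix_vector_mul_assoc matrix_exp_commute)
qed

end

theory Submission
  imports Defs
begin

text \<open>Write \<open>S\<close> for the symmetric part of \<open>A\<close> and \<open>C = [A, A\<^sup>T]\<close>.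

  The left-invariant metric at \<open>(s, x)\<close> is \<open>u\<^sub>0v\<^sub>0 + \<langle>Eu, Ev\<rangle>\<close> with \<open>E = exp (-sA)\<close>, so it depends on
  the coordinate \<open>s\<close> alone and all Christoffel symbols are explicit (\<open>christoffel_grp_metric\<close>).
  Tracing the curvature at the identity shows that the Ricci operator is \<open>-tr (S\<^sup>2)\<close> on \<open>e\<^sub>0\<close> and
  \<open>R = C/2 - tr (A) S\<close> on \<open>\<real>\<^sup>n\<close> (\<open>ricci_operator_grp_metric_0\<close>). A map acting as \<open>d\<close> on \<open>e\<^sub>0\<close> and as
  \<open>M\<close> on \<open>\<real>\<^sup>n\<close> is a derivation exactly when \<open>[M, A] = dA\<close>. The constant \<open>a\<close> in \<open>Ric = aI + D\<close> makes \<open>d\<close>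
  arbitrary and does not affect \<open>[M, A]\<close>, so \<open>\<mu>\<^sub>A\<close> is an algebraic soliton if and only if
  \<open>[A, C] - tr (A) C = cA\<close> for some \<open>c\<close> (\<open>algebraic_soliton_iff\<close>).

  Pairing this equation with \<open>A\<close> in the Frobenius inner product gives \<open>-|C|\<^sup>2 = c|A|\<^sup>2\<close>. Hence \<open>c = 0\<close>
  forces \<open>A\<close> to be normal. If \<open>c \<noteq> 0\<close>, taking traces gives \<open>tr A = 0\<close>, and then \<open>[C, A] = -cA\<close> makes \<open>A\<close>
  nilpotent, because \<open>ad C\<close> cannot have the infinitely many eigenvalues \<open>-kc\<close>
  (\<open>soliton_equation_iff\<close>).

  For such \<open>A\<close> the bracket flow field at \<open>A\<close> is \<open>-(k/2) A\<close> for a constant \<open>k\<close>. The field is homogeneous of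
  degree three, so on the line through \<open>A\<close> the flow is the scalar equation \<open>f' = -(k/2) f\<^sup>3\<close>, solved by
  \<open>(kt + 1)\<^bsup>-1/2\<^esup>\<close>. The field is polynomial, hence Lipschitz on balls, which makes solutions unique,
  and for \<open>A \<noteq> 0\<close> the explicit solution blows up where \<open>kt + 1\<close> vanishes, so it cannot be extended.\<close>

section \<open>Commutators and the Frobenius inner product\<close>

lemmas matrix_mult_bilinear =
  bounded_bilinear.add_left[OF bounded_bilinear_matrix_mult]
  bounded_bilinear.add_right[OF bounded_bilinear_matrix_mult]
  bounded_bilinear.diff_left[OF bounded_bilinear_matrix_mult]
  bounded_bilinear.diff_right[OF bounded_bilinear_matrix_mult]
  bounded_bilinear.minus_left[OF bounded_bilinear_matrix_mult]
  bounded_bilinear.minus_right[OF bounded_bilinear_matrix_mult]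
  matrix_scaleR_left matrix_scaleR_right

lemmas matrix_vector_bilinear =
  bounded_bilinear.add_left[OF bounded_bilinear_matrix_vector_mult]
  bounded_bilinear.add_right[OF bounded_bilinear_matrix_vector_mult]
  bounded_bilinear.diff_left[OF bounded_bilinear_matrix_vector_mult]
  bounded_bilinear.diff_right[OF bounded_bilinear_matrix_vector_mult]
  bounded_bilinear.minus_left[OF bounded_bilinear_matrix_vector_mult]
  bounded_bilinear.minus_right[OF bounded_bilinear_matrix_vector_mult]
  bounded_bilinear.scaleR_left[OF bounded_bilinear_matrix_vector_mult]
  bounded_bilinear.scaleR_right[OF bounded_bilinear_matrix_vector_mult]

lemma transpose_add: "transpose (A + B) = transpose A + transpose (B :: real^'n^'n)"
  by (simp add: transpose_def vec_eq_iff)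

lemma trace_scaleR: "trace (c *\<^sub>R A) = c * trace (A :: real^'n^'n)"
  by (simp add: trace_def sum_distrib_left)

lemma trace_transpose: "trace (transpose A) = trace (A :: real^'n^'n)"
  by (simp add: trace_def transpose_def)

lemma trace_commutator: "trace (commutator A B) = 0"
  using trace_mul_sym[of A B] by (simp add: commutator_def trace_sub)

lemma inner_eq_trace: "A \<bullet> B = trace (A ** transpose B)" for A B :: "real^'n^'n"
  by (simp add: inner_vec_def trace_def matrix_matrix_mult_def transpose_def)

lemma inner_mult_left: "(A ** B) \<bullet> C = B \<bullet> (transpose A ** C)" for A B C :: "real^'n^'n"
  by (simp add: inner_eq_trace matrix_transpose_mul trace_mul_sym[of A] flip: matrix_mul_assoc)

lemma inner_mult_right: "(A ** B) \<bullet> C = A \<bullet> (C ** transpose B)" for A B C :: "real^'n^'n"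
  by (simp add: inner_eq_trace matrix_transpose_mul flip: matrix_mul_assoc)

lemma commutator_scaleR:
  "commutator (r *\<^sub>R A) B = r *\<^sub>R commutator A B" "commutator A (r *\<^sub>R B) = r *\<^sub>R commutator A B"
  by (simp_all add: commutator_def matrix_mult_bilinear scaleR_diff_right)

lemma commutator_0_right [simp]: "commutator A 0 = 0"
  by (simp add: commutator_def)

text \<open>The adjoint of \<open>ad A\<close> for the Frobenius inner product is \<open>ad A\<^sup>T\<close>.\<close>

lemma inner_commutator_left: "commutator A B \<bullet> C = B \<bullet> commutator (transpose A) C"
  by (simp add: commutator_def inner_diff_left inner_diff_right inner_mult_left[of A B]
      inner_mult_right[of B A])

lemma normal_iff_commutator: "normal_matrix A \<longleftrightarrow> commutator A (transpose A) = 0"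
  by (simp add: normal_matrix_def commutator_def)

lemma transpose_sym_part [simp]: "transpose (sym_part A) = sym_part A"
  by (simp add: sym_part_def transpose_scalar transpose_add add.commute)

lemma trace_sym_part_sq:
  "trace (sym_part A ** sym_part A) = (1/2) * (trace (A ** transpose A) + trace (A ** A))"
proof -
  have "trace (transpose A ** transpose A) = trace (A ** A)"
    by (metis matrix_transpose_mul trace_transpose)
  then show ?thesis
    by (simp add: sym_part_def matrix_mult_bilinear trace_scaleR trace_add
        trace_mul_sym[of "transpose A" A] algebra_simps)
qed

section \<open>Nilpotent matrices\<close>

lemma matrix_power_add: "matrix_power A (j + k) = matrix_power A j ** matrix_power A k"
  by (induction j) (simp_all add: matrix_power_Suc matrix_mul_assoc)

text \<open>By the Leibniz rule \<open>[R, A\<^sup>k] = kd A\<^sup>k\<close>, so every nonzero \<open>A\<^sup>k\<close> is an eigenvector of \<open>ad R\<close> with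
  eigenvalue \<open>kd\<close>. These eigenvalues are unbounded in \<open>k\<close>, but \<open>ad R\<close> is a bounded operator.\<close>

lemma nilpotent_of_commutator_eigen:
  assumes eig: "commutator R A = d *\<^sub>R A" and "d \<noteq> 0"
  shows "nilpotent_matrix A"
proof -
  have pow: "commutator R (matrix_power A k) = (real k * d) *\<^sub>R matrix_power A k" for k
  proof (induction k)
    case 0
    then show ?case by (simp add: commutator_def)
  next
    case (Suc k)
    have "commutator R (matrix_power A (Suc k))
        = commutator R A ** matrix_power A k + A ** commutator R (matrix_power A k)"
      by (simp add: commutator_def matrix_power_Suc matrix_mult_bilinear matrix_mul_assoc)
    then show ?case
      by (simp add: Suc eig matrix_mult_bilinear matrix_power_Suc algebra_simps)
  qed
  have "bounded_linear (commutator R)"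
    unfolding commutator_def
    by (intro bounded_linear_sub bounded_bilinear.bounded_linear_right[OF bounded_bilinear_matrix_mult]
        bounded_bilinear.bounded_linear_left[OF bounded_bilinear_matrix_mult])
  then obtain K where K: "\<And>X. norm (commutator R X) \<le> norm X * K"
    using bounded_linear.bounded by blast
  obtain k where k: "K / \<bar>d\<bar> < real k"
    using reals_Archimedean2 by blast
  then have "K < real k * \<bar>d\<bar>"
    using \<open>d \<noteq> 0\<close> by (simp add: field_simps)
  moreover have "real k * \<bar>d\<bar> * norm (matrix_power A k) \<le> K * norm (matrix_power A k)"
    using K[of "matrix_power A k"] by (simp add: pow abs_mult mult.commute)
  ultimately have "norm (matrix_power A k) = 0"
    by (meson linorder_not_less mult_strict_right_mono norm_le_zero_iff order.antisym norm_ge_zero)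
  then show ?thesis
    by (auto simp: nilpotent_matrix_def)
qed

text \<open>For symmetric \<open>B\<close> one has \<open>|B\<^sup>k|\<^sup>2 = tr (B\<^sup>k B\<^sup>k)\<close>, so the vanishing of \<open>B\<^bsup>k+1\<^esup>\<close> implies that of
  \<open>B\<^sup>k\<close> as long as \<open>2k \<ge> k + 1\<close>; the exponent descends to one.\<close>

lemma symmetric_nilpotent_eq_0:
  assumes sym: "transpose B = B" and "matrix_power B k = 0"
  shows "B = 0"
  using assms(2)
proof (induction k)
  case 0
  then have "B = 0 ** B" by (metis matrix_mul_lid matrix_power_0)
  then show ?case by simp
next
  case step: (Suc k)
  show ?case
  proof (cases k)
    case 0
    then show ?thesis using step.prems by (simp add: matrix_power_Suc)
  next
    case (Suc m)
    have tr: "transpose (matrix_power B k) = matrix_power B k"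
      by (induction k) (simp_all add: matrix_power_Suc matrix_transpose_mul sym
          flip: matrix_power_Suc_right)
    have "matrix_power B (k + k) = 0"
      using step.prems Suc matrix_power_add[of B "Suc k" m] by simp
    then have "matrix_power B k \<bullet> matrix_power B k = 0"
      by (simp add: inner_eq_trace tr flip: matrix_power_add) (simp add: trace_def)
    then show ?thesis
      using step.IH by simp
  qed
qed

text \<open>For normal \<open>A\<close> the powers of the symmetric matrix \<open>A\<^sup>TA\<close> are \<open>(A\<^sup>T)\<^sup>kA\<^sup>k\<close>, so \<open>A\<^sup>TA\<close> is nilpotent, hence
  zero, and \<open>|A|\<^sup>2\<close> is its trace.\<close>

lemma normal_nilpotent_eq_0:
  assumes "normal_matrix A" "nilpotent_matrix A"
  shows "A = 0"
proof -
  from assms obtain k where k: "matrix_power A k = 0"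
    by (auto simp: nilpotent_matrix_def)
  have AT: "A ** transpose A = transpose A ** A"
    using assms by (simp add: normal_matrix_def)
  have comm: "matrix_power A k ** transpose A = transpose A ** matrix_power A k" for k
  proof (induction k)
    case (Suc k)
    have "matrix_power A (Suc k) ** transpose A = A ** (matrix_power A k ** transpose A)"
      by (simp add: matrix_power_Suc matrix_mul_assoc)
    also have "\<dots> = transpose A ** matrix_power A (Suc k)"
      by (simp add: Suc matrix_mul_assoc AT matrix_power_Suc)
    finally show ?case .
  qed simp
  have "matrix_power (transpose A ** A) k = matrix_power (transpose A) k ** matrix_power A k" for k
  proof (induction k)
    case (Suc k)
    have "matrix_power (transpose A ** A) (Suc k)
        = matrix_power (transpose A) k ** (matrix_power A k ** transpose A) ** A"
      by (simp add: matrix_power_Suc_right Suc matrix_mul_assoc)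
    then show ?case
      by (simp add: comm matrix_power_Suc_right matrix_mul_assoc)
  qed simp
  then have "matrix_power (transpose A ** A) k = 0"
    by (simp add: k)
  then have "transpose A ** A = 0"
    by (rule symmetric_nilpotent_eq_0[rotated]) (simp add: matrix_transpose_mul)
  then have "A \<bullet> A = 0"
    by (simp add: inner_mult_left[of A "mat 1", simplified])
  then show ?thesis by simp
qed

section \<open>The soliton equation for matrices\<close>

text \<open>Both \<open>AA\<^sup>T\<close> and \<open>A\<^sup>TA\<close> have inner product \<open>\<langle>A, A\<^sup>2\<rangle>\<close> with \<open>A\<close>.\<close>

lemma inner_commutator_transpose_self: "commutator A (transpose A) \<bullet> A = 0"
  using inner_mult_right[of A "transpose A" A] inner_mult_left[of "transpose A" A A]
  by (simp add: commutator_def inner_diff_left)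

lemma inner_commutator_commutator:
  "commutator A (commutator A (transpose A)) \<bullet> A = - (norm (commutator A (transpose A)))\<^sup>2"
proof -
  have "commutator (transpose A) A = - commutator A (transpose A)"
    by (simp add: commutator_def)
  then show ?thesis
    by (simp add: inner_commutator_left[of A "commutator A (transpose A)"] power2_norm_eq_inner)
qed

text \<open>If \<open>c \<noteq> 0\<close>, then \<open>A\<close> is a multiple of a commutator \<open>[A, C]\<close>, so it is
  traceless, and it is orthogonal to \<open>A\<^sup>T\<close> because \<open>ad A\<close> has the adjoint \<open>ad A\<^sup>T\<close>, which kills \<open>A\<^sup>T\<close>. If
  \<open>c = 0\<close>, then \<open>A\<close> is normal and therefore zero.\<close>

lemma nilpotent_soliton_traces:
  assumes "nilpotent_matrix A" and eq: "commutator A (commutator A (transpose A)) = c *\<^sub>R A"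
  shows "trace A = 0" "trace (A ** A) = 0"
proof -
  have "trace A = 0 \<and> trace (A ** A) = 0"
  proof (cases "c = 0")
    case True
    then have "normal_matrix A"
      using eq inner_commutator_commutator[of A] by (simp add: normal_iff_commutator)
    then have "A = 0"
      using assms normal_nilpotent_eq_0 by blast
    then show ?thesis
      by (simp add: trace_def)
  next
    case False
    have "c * trace A = 0"
      using arg_cong[OF eq, of trace] by (simp add: trace_commutator trace_scaleR)
    moreover have "c * (A \<bullet> transpose A) = 0"
      using inner_commutator_left[of A "commutator A (transpose A)" "transpose A"]
      by (simp add: eq commutator_def[of "transpose A" "transpose A"])
    ultimately show ?thesis
      using False by (simp add: inner_eq_trace)
  qed
  then show "trace A = 0" "trace (A ** A) = 0" by auto
qed

text \<open>Pairing with \<open>A\<close> separates the cases: if \<open>c = 0\<close> it gives \<open>|C|\<^sup>2 = 0\<close>, while for \<open>c \<noteq> 0\<close> the trace of \<open>A\<close>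
  vanishes and \<open>A\<close> is an eigenvector of \<open>ad C\<close> with nonzero eigenvalue, hence nilpotent.\<close>

lemma soliton_equation_iff:
  fixes A :: "real^'n^'n"
  shows "(\<exists>c. commutator A (commutator A (transpose A)) - trace A *\<^sub>R commutator A (transpose A) = c *\<^sub>R A)
    \<longleftrightarrow> normal_matrix A \<or>
      (nilpotent_matrix A \<and> (\<exists>c. commutator A (commutator A (transpose A)) = c *\<^sub>R A))"
    (is "(\<exists>c. ?eq c) \<longleftrightarrow> _")
proof
  let ?C = "commutator A (transpose A)"
  assume "\<exists>c. ?eq c"
  then obtain c where c: "?eq c" ..
  show "normal_matrix A \<or> (nilpotent_matrix A \<and> (\<exists>c. commutator A ?C = c *\<^sub>R A))"
  proof (cases "c = 0")
    case True
    then have "(commutator A ?C - trace A *\<^sub>R ?C) \<bullet> A = 0"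
      using c by simp
    then have "normal_matrix A"
      by (simp add: inner_diff_left inner_commutator_commutator inner_commutator_transpose_self
          normal_iff_commutator)
    then show ?thesis ..
  next
    case False
    have "c * trace A = 0"
      using arg_cong[OF c, of trace] by (simp add: trace_sub trace_commutator trace_scaleR)
    then have "trace A = 0"
      using False by simp
    then have eq: "commutator A ?C = c *\<^sub>R A"
      using c by simp
    then have "commutator ?C A = (- c) *\<^sub>R A"
      by (simp add: commutator_def[of ?C A] commutator_def[of A ?C] flip: eq)
    then have "nilpotent_matrix A"
      by (rule nilpotent_of_commutator_eigen) (simp add: False)
    then show ?thesis
      using eq by blast
  qed
next
  assume "normal_matrix A \<or> (nilpotent_matrix A \<and> (\<exists>c. commutator A (commutator A (transpose A)) = c *\<^sub>R A))"
  then show "\<exists>c. ?eq c"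
  proof
    assume "normal_matrix A"
    then show ?thesis
      by (intro exI[of _ 0]) (simp add: normal_iff_commutator)
  next
    assume "nilpotent_matrix A \<and> (\<exists>c. commutator A (commutator A (transpose A)) = c *\<^sub>R A)"
    then obtain c where "nilpotent_matrix A" "commutator A (commutator A (transpose A)) = c *\<^sub>R A"
      by blast
    then show ?thesis
      using nilpotent_soliton_traces(1)[of A c] by (intro exI[of _ c]) simp
  qed
qed

section \<open>The left-invariant metric and its Christoffel symbols\<close>

lemma inner_matrix_transpose: "(x :: real^'n) \<bullet> (transpose A *v y) = (A *v x) \<bullet> y"
  by (metis dot_lmul_matrix inner_commute transpose_matrix_vector)

lemma inner_sym_part: "(x :: real^'n) \<bullet> (sym_part A *v y) = (1/2) * ((A *v x) \<bullet> y + x \<bullet> (A *v y))"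
  by (simp add: sym_part_def matrix_vector_bilinear inner_add_right inner_matrix_transpose
    del: transpose_matrix_vector)

lemma sym_part_self_adjoint: "(sym_part A *v x) \<bullet> y = (x :: real^'n) \<bullet> (sym_part A *v y)"
  using inner_matrix_transpose[of x "sym_part A" y] by simp

lemma matrix_exp_inverse:
  "matrix_exp (s *\<^sub>R A) *v (matrix_exp (- s *\<^sub>R A) *v x) = (x :: real^'n)"
  "matrix_exp (- s *\<^sub>R A) *v (matrix_exp (s *\<^sub>R A) *v x) = (x :: real^'n)"
  unfolding matrix_vector_mul_assoc matrix_exp_add_scaleR[symmetric] by simp_all

lemma has_derivative_matrix_exp_vector:
  fixes A :: "real^'n^'n" and f :: "'a::real_normed_vector \<Rightarrow> real"
  assumes "(f has_derivative f') (at p)"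
  shows "((\<lambda>q. matrix_exp (f q *\<^sub>R A) *v x) has_derivative
    (\<lambda>w. f' w *\<^sub>R (A *v (matrix_exp (f p *\<^sub>R A) *v x)))) (at p)"
proof -
  have "((\<lambda>q. matrix_exp (f q *\<^sub>R A)) has_derivative (\<lambda>w. f' w *\<^sub>R (A ** matrix_exp (f p *\<^sub>R A)))) (at p)"
    using has_derivative_compose[OF assms
        has_vector_derivative_matrix_exp[of A "f p", unfolded has_vector_derivative_def]] .
  from bounded_linear.has_derivative[OF
      bounded_bilinear.bounded_linear_left[OF bounded_bilinear_matrix_vector_mult] this, of x]
  show ?thesis
    by (simp add: matrix_vector_bilinear matrix_vector_mul_assoc)
qed

lemma grp_metric_eq:
  "grp_metric A p u v = fst u * fst v
    + (matrix_exp (- fst p *\<^sub>R A) *v snd u) \<bullet> (matrix_exp (- fst p *\<^sub>R A) *v snd v)"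
proof -
  have "(grp_mult A q has_derivative (\<lambda>v. (fst v, matrix_exp (fst q *\<^sub>R A) *v snd v))) (at p)" for q
    unfolding grp_mult_def
    by (auto intro!: derivative_eq_intros
        bounded_linear.has_derivative[OF matrix_vector_mul_bounded_linear])
  note D = frechet_derivative_at[OF this, symmetric]
  show ?thesis
    unfolding grp_metric_def left_invariant_metric_def D by (simp add: grp_inv_def)
qed

text \<open>The metric varies only in the \<open>e\<^sub>0\<close> direction. Differentiating \<open>E = exp (-sA)\<close> in both slots of
  \<open>\<langle>Eu, Ev\<rangle>\<close> produces \<open>-(A + A\<^sup>T) = -2S\<close> between them.\<close>

lemma frechet_derivative_grp_metric:
  "frechet_derivative (\<lambda>q. grp_metric A q u v) (at p) w
    = - 2 * fst w * ((matrix_exp (- fst p *\<^sub>R A) *v snd u) \<bullet>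
        (sym_part A *v (matrix_exp (- fst p *\<^sub>R A) *v snd v)))"
proof -
  let ?x = "matrix_exp (- fst p *\<^sub>R A) *v snd u" and ?y = "matrix_exp (- fst p *\<^sub>R A) *v snd v"
  have E: "((\<lambda>q. matrix_exp (- fst q *\<^sub>R A) *v x) has_derivative
      (\<lambda>w. (- fst w) *\<^sub>R (A *v (matrix_exp (- fst p *\<^sub>R A) *v x)))) (at p)" for x
    by (rule has_derivative_matrix_exp_vector) (auto intro!: derivative_eq_intros)
  have "((\<lambda>q. grp_metric A q u v) has_derivative
      (\<lambda>w. 0 + (?x \<bullet> ((- fst w) *\<^sub>R (A *v ?y)) + ((- fst w) *\<^sub>R (A *v ?x)) \<bullet> ?y))) (at p)"
    unfolding grp_metric_eq by (intro has_derivative_add has_derivative_const has_derivative_inner E)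
  then show ?thesis
    by (simp add: frechet_derivative_at[symmetric] inner_sym_part algebra_simps)
qed

lemma grp_metric_nondegenerate:
  assumes "\<And>z. grp_metric A p u z = grp_metric A p v z"
  shows "u = v"
proof -
  have "grp_metric A p (u - v) (u - v) = 0"
    using assms[of "u - v"]
    by (simp add: grp_metric_eq matrix_vector_bilinear inner_diff_left algebra_simps)
  then have "fst (u - v) = 0 \<and> matrix_exp (- fst p *\<^sub>R A) *v snd (u - v) = 0"
    unfolding grp_metric_eq by (simp add: add_nonneg_eq_0_iff)
  then show ?thesis
    using matrix_exp_inverse(1)[of "fst p" A "snd (u - v)"] by (simp add: prod_eq_iff)
qed

text \<open>In the Koszul formula the terms along \<open>u\<close> and \<open>v\<close> determine the \<open>\<real>\<^sup>n\<close> component and the term along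
  \<open>z\<close> the \<open>e\<^sub>0\<close> component. The factor \<open>exp (sA)\<close> in front is what remains of the inverse of the metric
  \<open>E\<^sup>TE\<close> after cancelling \<open>E\<^sup>T\<close>.\<close>

lemma christoffel_grp_metric:
  "christoffel (grp_metric A) p u v =
    ((matrix_exp (- fst p *\<^sub>R A) *v snd u) \<bullet> (sym_part A *v (matrix_exp (- fst p *\<^sub>R A) *v snd v)),
     - (matrix_exp (fst p *\<^sub>R A) *v (sym_part A *v (matrix_exp (- fst p *\<^sub>R A) *v
          (fst u *\<^sub>R snd v + fst v *\<^sub>R snd u)))))"
  (is "_ = ?w")
proof -
  have eq: "2 * grp_metric A p ?w z =
      frechet_derivative (\<lambda>q. grp_metric A q v z) (at p) u
    + frechet_derivative (\<lambda>q. grp_metric A q u z) (at p) v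
    - frechet_derivative (\<lambda>q. grp_metric A q u v) (at p) z" for z
    unfolding frechet_derivative_grp_metric
    by (simp add: grp_metric_eq matrix_vector_bilinear matrix_exp_inverse[simplified]
        sym_part_self_adjoint inner_add_left algebra_simps)
  show ?thesis
    unfolding christoffel_def
  proof (intro the_equality allI eq)
    fix w assume w: "\<forall>z. 2 * grp_metric A p w z =
        frechet_derivative (\<lambda>q. grp_metric A q v z) (at p) u
      + frechet_derivative (\<lambda>q. grp_metric A q u z) (at p) v
      - frechet_derivative (\<lambda>q. grp_metric A q u v) (at p) z"
    have "2 * grp_metric A p w z = 2 * grp_metric A p ?w z" for z
      unfolding eq w[rule_format] ..
    then show "w = ?w"
      by (intro grp_metric_nondegenerate) simp
  qed
qed

section \<open>The Ricci operator at the identity\<close>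

lemma christoffel_grp_metric_0:
  "christoffel (grp_metric A) 0 u v =
    (snd u \<bullet> (sym_part A *v snd v), - (sym_part A *v (fst u *\<^sub>R snd v + fst v *\<^sub>R snd u)))"
  by (simp add: christoffel_grp_metric)

text \<open>The two components of the Christoffel symbols involve \<open>E\<^sup>TSE\<close> and \<open>E\<^bsup>-1\<^esup>SE\<close>, whose derivatives in
  \<open>s\<close> at the identity are \<open>-(A\<^sup>TS + SA)\<close> and \<open>[A, S]\<close>.\<close>

lemma frechet_derivative_christoffel:
  fixes A :: "real^'n^'n"
  shows "frechet_derivative (\<lambda>p. christoffel (grp_metric A) p u v) (at 0) w =
    fst w *\<^sub>R (- ((A *v snd u) \<bullet> (sym_part A *v snd v) + snd u \<bullet> (sym_part A *v (A *v snd v))),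
      - (commutator A (sym_part A) *v (fst u *\<^sub>R snd v + fst v *\<^sub>R snd u)))"
proof -
  let ?S = "sym_part A" and ?x = "fst u *\<^sub>R snd v + fst v *\<^sub>R snd u"
  have E: "((\<lambda>q :: real \<times> (real^'n). matrix_exp (- fst q *\<^sub>R A) *v x) has_derivative (\<lambda>w. (- fst w) *\<^sub>R (A *v x))) (at 0)"
    for x
  proof -
    have "((\<lambda>q :: real \<times> (real^'n). - fst q) has_derivative (\<lambda>w. - fst w)) (at 0)"
      by (auto intro!: derivative_eq_intros)
    from has_derivative_matrix_exp_vector[OF this, of A x] show ?thesis by simp
  qed
  have SE: "((\<lambda>q :: real \<times> (real^'n). ?S *v (matrix_exp (- fst q *\<^sub>R A) *v x)) has_derivative
      (\<lambda>w. ?S *v ((- fst w) *\<^sub>R (A *v x)))) (at 0)" for x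
    by (intro bounded_linear.has_derivative[OF matrix_vector_mul_bounded_linear] E)
  have F: "((\<lambda>q :: real \<times> (real^'n). matrix_exp (fst q *\<^sub>R A)) has_derivative (\<lambda>w. fst w *\<^sub>R A)) (at 0)"
    using has_derivative_compose[OF has_derivative_fst[OF has_derivative_ident]
        has_vector_derivative_matrix_exp[of A "fst 0", unfolded has_vector_derivative_def]]
    by simp
  have "((\<lambda>p. christoffel (grp_metric A) p u v) has_derivative
      (\<lambda>w. (snd u \<bullet> (?S *v ((- fst w) *\<^sub>R (A *v snd v))) + ((- fst w) *\<^sub>R (A *v snd u)) \<bullet> (?S *v snd v),
         - (?S *v ((- fst w) *\<^sub>R (A *v ?x)) + (fst w *\<^sub>R A) *v (?S *v ?x))))) (at 0)"
    unfolding christoffel_grp_metric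
    using has_derivative_inner[OF E[of "snd u"] SE[of "snd v"]]
      bounded_bilinear.FDERIV[OF bounded_bilinear_matrix_vector_mult F SE[of ?x]]
    by (intro has_derivative_Pair has_derivative_minus) simp_all
  then show ?thesis
    by (simp add: frechet_derivative_at[symmetric] matrix_vector_bilinear matrix_mult_bilinear
        commutator_def matrix_vector_mul_assoc algebra_simps)
qed

text \<open>Constant fields commute and the covariant derivative of a constant field along a constant field is
  a Christoffel symbol, which leaves the classical coordinate formula.\<close>

lemma curvature_tensor_grp_metric_0:
  fixes A :: "real^'n^'n"
  shows "curvature_tensor (grp_metric A) 0 u v w =
    frechet_derivative (\<lambda>p. christoffel (grp_metric A) p v w) (at 0) u
    + christoffel (grp_metric A) 0 u (christoffel (grp_metric A) 0 v w)
    - frechet_derivative (\<lambda>p. christoffel (grp_metric A) p u w) (at 0) v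
    - christoffel (grp_metric A) 0 v (christoffel (grp_metric A) 0 u w)"
proof -
  have const: "frechet_derivative (\<lambda>_. c) (at p) = (\<lambda>_. 0)"
    for c :: "real \<times> (real^'n)" and p :: "real \<times> (real^'n)"
    by (rule frechet_derivative_at[symmetric]) (rule has_derivative_const)
  have nabla: "levi_civita g (\<lambda>_. u) (\<lambda>_. v) = (\<lambda>p. christoffel g p u v)"
    for g and u v :: "real \<times> (real^'n)"
    by (simp add: levi_civita_def const fun_eq_iff)
  have "field_bracket (\<lambda>_. u) (\<lambda>_. v) = (\<lambda>_. 0)"
    by (simp add: field_bracket_def const fun_eq_iff)
  moreover have "christoffel (grp_metric A) 0 0 w = 0"
    unfolding christoffel_grp_metric_0 by (simp add: zero_prod_def)
  ultimately show ?thesis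
    by (simp add: curvature_tensor_def curvature_field_def nabla levi_civita_def)
qed

lemma sum_Basis_vec: "(\<Sum>b\<in>(Basis :: (real^'n) set). f b) = (\<Sum>i\<in>UNIV. f (axis i 1))"
proof -
  have "Basis = range (\<lambda>i. axis i (1::real) :: real^'n)"
    by (auto simp: Basis_vec_def)
  moreover have "inj (\<lambda>i. axis i (1::real) :: real^'n)"
    by (auto simp: inj_on_def axis_eq_axis)
  ultimately show ?thesis
    by (intro sum.reindex_cong[where l="\<lambda>i. axis i 1"]) auto
qed

lemma sum_Basis_real_prod:
  "(\<Sum>b\<in>(Basis :: (real \<times> 'a::euclidean_space) set). f b) = f (1, 0) + (\<Sum>b\<in>Basis. f (0, b))"
proof -
  have B: "Basis = insert (1::real, 0) (Pair 0 ` (Basis :: 'a set))"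
    by (auto simp: Basis_prod_def)
  have "(1::real, 0) \<notin> Pair (0::real) ` (Basis :: 'a set)"
    by auto
  then show ?thesis
    unfolding B by (simp add: sum.reindex inj_on_def)
qed

lemma sum_inner_Basis_eq_trace: "(\<Sum>b\<in>Basis. (M *v b) \<bullet> b) = trace (M :: real^'n^'n)"
  by (simp add: sum_Basis_vec inner_axis trace_def matrix_vector_mult_basis column_def)

text \<open>The basis vector \<open>e\<^sub>0\<close> contributes only to the \<open>\<real>\<^sup>n\<close> block. The vectors of \<open>\<real>\<^sup>n\<close> contribute traces of
  \<open>S\<close>, \<open>S\<^sup>2\<close> and \<open>[A, S]\<close>, the last of which vanishes, and a second copy of \<open>\<langle>Su, Sv\<rangle>\<close>.\<close>

lemma ricci_tensor_grp_metric_0: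
  "ricci_tensor (grp_metric A) 0 u v =
    - trace (sym_part A ** sym_part A) * (fst u * fst v)
    + ((1/2) *\<^sub>R commutator A (transpose A) *v snd u - trace A *\<^sub>R sym_part A *v snd u) \<bullet> snd v"
proof -
  let ?S = "sym_part A"
  have tr: "trace ?S = trace A"
    by (simp add: sym_part_def trace_scaleR trace_add trace_transpose)
  have e0: "curvature_tensor (grp_metric A) 0 (1, 0) u v \<bullet> (1, 0)
      = - ((A *v snd u) \<bullet> (?S *v snd v) + snd u \<bullet> (?S *v (A *v snd v))) + (?S *v snd u) \<bullet> (?S *v snd v)"
    unfolding curvature_tensor_grp_metric_0 frechet_derivative_christoffel christoffel_grp_metric_0
    by (simp add: matrix_vector_bilinear sym_part_self_adjoint)
  have ei: "curvature_tensor (grp_metric A) 0 (0, b) u v \<bullet> (0, b)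
      = - (snd u \<bullet> (?S *v snd v)) * ((?S *v b) \<bullet> b) + (fst u * fst v) * ((commutator A ?S *v b) \<bullet> b)
        - (fst u * fst v) * (((?S ** ?S) *v b) \<bullet> b) + ((?S *v snd v) \<bullet> b) * ((?S *v snd u) \<bullet> b)" for b
    using sym_part_self_adjoint[of A b "snd v"] inner_commute[of "?S *v b" "snd v"]
    unfolding curvature_tensor_grp_metric_0 frechet_derivative_christoffel christoffel_grp_metric_0
    by (simp add: matrix_vector_bilinear sym_part_self_adjoint matrix_vector_mul_assoc[symmetric]
      inner_diff_left inner_add_left algebra_simps)
  have ricci: "ricci_tensor (grp_metric A) 0 u v
      = - ((A *v snd u) \<bullet> (?S *v snd v) + snd u \<bullet> (?S *v (A *v snd v))) + (?S *v snd u) \<bullet> (?S *v snd v)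
        - (snd u \<bullet> (?S *v snd v)) * trace ?S + (fst u * fst v) * trace (commutator A ?S)
        - (fst u * fst v) * trace (?S ** ?S) + (?S *v snd v) \<bullet> (?S *v snd u)"
    unfolding ricci_tensor_def sum_Basis_real_prod
    by (simp add: e0 ei sum.distrib sum_subtractf sum_negf sum_inner_Basis_eq_trace
        euclidean_inner[of "?S *v snd v" "?S *v snd u"] flip: sum_distrib_left)
  \<comment> \<open>As matrices, \<open>2S\<^sup>2 - A\<^sup>TS - SA = [A, A\<^sup>T]/2\<close>.\<close>
  have S_sq: "- ((A *v x) \<bullet> (?S *v y) + x \<bullet> (?S *v (A *v y))) + 2 * ((?S *v x) \<bullet> (?S *v y))
      = ((1/2) *\<^sub>R commutator A (transpose A) *v x) \<bullet> y" for x y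
  proof -
    define A' where "A' = transpose A"
    have adj: "x \<bullet> (A' *v y) = (A *v x) \<bullet> y" "(A' *v x) \<bullet> y = x \<bullet> (A *v y)" for x y
      unfolding A'_def by (metis inner_matrix_transpose inner_commute)+
    have S: "?S *v x = (1/2) *\<^sub>R (A *v x + A' *v x)" for x
      by (simp add: sym_part_def A'_def matrix_vector_bilinear)
    have C: "commutator A A' *v x = A *v (A' *v x) - A' *v (A *v x)"
      by (simp add: commutator_def matrix_vector_bilinear matrix_vector_mul_assoc)
    have "x \<bullet> (?S *v (A *v y)) = (?S *v x) \<bullet> (A *v y)"
      by (simp add: sym_part_self_adjoint)
    then show ?thesis
      unfolding A'_def[symmetric] matrix_vector_bilinear C inner_scaleR_left inner_diff_left
      using adj(1)[of "A' *v x" y] adj(2)[of "A *v x" y]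
      by (simp add: S inner_add_left inner_add_right algebra_simps)
  qed
  have "((1/2) *\<^sub>R commutator A (transpose A) *v snd u - trace A *\<^sub>R ?S *v snd u) \<bullet> snd v
      = ((1/2) *\<^sub>R commutator A (transpose A) *v snd u) \<bullet> snd v - trace A * (snd u \<bullet> (?S *v snd v))"
    by (simp add: inner_diff_left matrix_vector_bilinear sym_part_self_adjoint)
  then show ?thesis
    unfolding ricci tr trace_commutator S_sq[symmetric] inner_commute[of "?S *v snd v" "?S *v snd u"]
    by (simp add: algebra_simps)
qed

lemma ricci_operator_grp_metric_0:
  "ricci_operator (grp_metric A) 0 v =
    (- trace (sym_part A ** sym_part A) * fst v,
     ((1/2) *\<^sub>R commutator A (transpose A) - trace A *\<^sub>R sym_part A) *v snd v)"
  (is "_ = ?w")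
proof -
  have g: "grp_metric A 0 w z = w \<bullet> z" for w z
    by (simp add: grp_metric_eq inner_prod_def)
  have Ric: "ricci_tensor (grp_metric A) 0 v z = ?w \<bullet> z" for z
    by (simp add: ricci_tensor_grp_metric_0 inner_prod_def matrix_vector_bilinear)
  show ?thesis
    unfolding ricci_operator_def g
  proof (intro the_equality allI)
    fix w assume "\<forall>z. w \<bullet> z = ricci_tensor (grp_metric A) 0 v z"
    then have "w \<bullet> z = ?w \<bullet> z" for z
      using Ric by metis
    then show "w = ?w"
      using vector_eq_rdot by blast
  qed (rule Ric[symmetric])
qed

section \<open>The soliton condition as a matrix equation\<close>

text \<open>The only bracket that carries information is \<open>\<mu>(e\<^sub>0, y) = Ay\<close>, on which the Leibniz rule reads
  \<open>MA = dA + AM\<close>.\<close>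

lemma derivation_mu_diagonal_iff:
  fixes A M :: "real^'n^'n"
  shows "derivation (mu A) (\<lambda>v. (d * fst v, M *v snd v)) \<longleftrightarrow> commutator M A = d *\<^sub>R A"
proof -
  have lin: "linear (\<lambda>v. (d * fst v, M *v snd v))"
    by (rule linearI) (simp_all add: matrix_vector_bilinear algebra_simps)
  show ?thesis
  proof
    assume D: "derivation (mu A) (\<lambda>v. (d * fst v, M *v snd v))"
    have "M *v (A *v y) = d *\<^sub>R (A *v y) + A *v (M *v y)" for y
      using D[unfolded derivation_def, THEN conjunct2, rule_format, of "(1, 0)" "(0, y)"]
      by (simp add: mu_def)
    then show "commutator M A = d *\<^sub>R A"
      by (simp add: matrix_eq commutator_def matrix_vector_bilinear algebra_simps
        flip: matrix_vector_mul_assoc)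
  next
    assume "commutator M A = d *\<^sub>R A"
    then have "M *v (A *v y) = d *\<^sub>R (A *v y) + A *v (M *v y)" for y
      by (simp add: matrix_eq commutator_def matrix_vector_bilinear algebra_simps
        flip: matrix_vector_mul_assoc)
    then show "derivation (mu A) (\<lambda>v. (d * fst v, M *v snd v))"
      by (simp add: derivation_def lin mu_def matrix_vector_bilinear algebra_simps)
  qed
qed

text \<open>Since \<open>a\<close> is free, so is the eigenvalue \<open>-tr (S\<^sup>2) - a\<close> of the derivation on \<open>e\<^sub>0\<close>, whereas \<open>a\<close> drops out
  of the commutator on \<open>\<real>\<^sup>n\<close>, which is \<open>[C/2 - tr (A) S, A] = -([A, C] - tr (A) C)/2\<close>.\<close>

lemma algebraic_soliton_iff:
  "algebraic_soliton A \<longleftrightarrow>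
    (\<exists>c. commutator A (commutator A (transpose A)) - trace A *\<^sub>R commutator A (transpose A) = c *\<^sub>R A)"
proof -
  let ?C = "commutator A (transpose A)"
  define R where "R = (1/2) *\<^sub>R ?C - trace A *\<^sub>R sym_part A"
  define r where "r = - trace (sym_part A ** sym_part A)"
  have Ric: "ricci_operator (grp_metric A) 0 = (\<lambda>v. (r * fst v, R *v snd v))"
    by (simp add: fun_eq_iff R_def r_def ricci_operator_grp_metric_0)
  have diff: "(\<lambda>v. ricci_operator (grp_metric A) 0 v - a *\<^sub>R v)
      = (\<lambda>v. ((r - a) * fst v, (R - a *\<^sub>R mat 1) *v snd v))" for a
    by (simp add: Ric fun_eq_iff prod_eq_iff matrix_vector_bilinear left_diff_distrib)
  have comm: "commutator (R - a *\<^sub>R mat 1) A = - (1/2) *\<^sub>R (commutator A ?C - trace A *\<^sub>R ?C)" for a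
    by (simp add: R_def commutator_def sym_part_def matrix_mult_bilinear algebra_simps)
  have "algebraic_soliton A \<longleftrightarrow> (\<exists>a D. derivation (mu A) D \<and> D = (\<lambda>v. ricci_operator (grp_metric A) 0 v - a *\<^sub>R v))"
    unfolding algebraic_soliton_def by (simp add: fun_eq_iff algebra_simps) metis
  also have "\<dots> \<longleftrightarrow> (\<exists>a. - (1/2) *\<^sub>R (commutator A ?C - trace A *\<^sub>R ?C) = (r - a) *\<^sub>R A)"
    by (simp add: diff derivation_mu_diagonal_iff comm)
  also have "\<dots> \<longleftrightarrow> (\<exists>c. commutator A ?C - trace A *\<^sub>R ?C = c *\<^sub>R A)"
  proof safe
    fix a assume "- (1/2) *\<^sub>R (commutator A ?C - trace A *\<^sub>R ?C) = (r - a) *\<^sub>R A"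
    then have "(-2) *\<^sub>R (- (1/2) *\<^sub>R (commutator A ?C - trace A *\<^sub>R ?C)) = (-2) *\<^sub>R ((r - a) *\<^sub>R A)"
      by (rule arg_cong)
    then show "\<exists>c. commutator A ?C - trace A *\<^sub>R ?C = c *\<^sub>R A"
      by (intro exI[of _ "-2 * (r - a)"]) simp
  next
    fix c assume "commutator A ?C - trace A *\<^sub>R ?C = c *\<^sub>R A"
    then show "\<exists>a. - (1/2) *\<^sub>R (commutator A ?C - trace A *\<^sub>R ?C) = (r - a) *\<^sub>R A"
      by (intro exI[of _ "r + c / 2"]) simp
  qed
  finally show ?thesis .
qed
section \<open>Uniqueness for ordinary differential equations\<close>

text \<open>Polynomial maps satisfy this condition although they need not be globally Lipschitz, and unlike
  a pointwise local condition it applies at once to two solutions on a compact time interval.\<close>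

definition lipschitz_on_balls :: "('a::real_normed_vector \<Rightarrow> 'b::real_normed_vector) \<Rightarrow> bool" where
  "lipschitz_on_balls f \<longleftrightarrow> (\<forall>r. \<exists>L. L-lipschitz_on (cball 0 r) f)"

lemma lipschitz_on_balls_linear: "bounded_linear f \<Longrightarrow> lipschitz_on_balls f"
  unfolding lipschitz_on_balls_def by (metis bounded_linear.lipschitz_boundE)

lemma lipschitz_on_balls_add:
  "lipschitz_on_balls f \<Longrightarrow> lipschitz_on_balls g \<Longrightarrow> lipschitz_on_balls (\<lambda>x. f x + g x)"
  unfolding lipschitz_on_balls_def by (metis lipschitz_on_add)

lemma lipschitz_on_balls_diff:
  "lipschitz_on_balls f \<Longrightarrow> lipschitz_on_balls g \<Longrightarrow> lipschitz_on_balls (\<lambda>x. f x - g x)"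
  unfolding lipschitz_on_balls_def by (metis lipschitz_on_diff)

lemma lipschitz_on_balls_minus: "lipschitz_on_balls f \<Longrightarrow> lipschitz_on_balls (\<lambda>x. - f x)"
  unfolding lipschitz_on_balls_def by (metis lipschitz_on_minus)

lemma lipschitz_on_balls_bounded:
  assumes "lipschitz_on_balls f"
  obtains M where "0 \<le> M" "\<And>x. norm x \<le> r \<Longrightarrow> norm (f x) \<le> M"
proof -
  obtain L where L: "L-lipschitz_on (cball 0 r) f"
    using assms unfolding lipschitz_on_balls_def by blast
  have L0: "0 \<le> L" using L by (rule lipschitz_on_nonneg)
  have "norm (f x) \<le> norm (f 0) + L * \<bar>r\<bar>" if "norm x \<le> r" for x
  proof -
    have "0 \<le> r" using that norm_ge_zero[of x] by linarith
    then have "norm (f x - f 0) \<le> L * norm (x - 0)"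
      using that by (intro lipschitz_on_normD[OF L]) auto
    also have "\<dots> \<le> L * \<bar>r\<bar>"
      using that L0 by (intro mult_left_mono) auto
    finally show ?thesis
      using norm_triangle_sub[of "f x" "f 0"] by linarith
  qed
  then show ?thesis
    using that[of "norm (f 0) + L * \<bar>r\<bar>"] L0 by simp
qed

text \<open>The product rule needs the factors to be bounded on the ball, which Lipschitz continuity there
  provides; it yields Lipschitz continuity of polynomial maps.\<close>

lemma lipschitz_on_balls_bilinear:
  fixes f :: "'a::real_normed_vector \<Rightarrow> 'b::real_normed_vector"
    and g :: "'a \<Rightarrow> 'c::real_normed_vector"
  assumes h: "bounded_bilinear h" and f: "lipschitz_on_balls f" and g: "lipschitz_on_balls g"
  shows "lipschitz_on_balls (\<lambda>x. h (f x) (g x))"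
  unfolding lipschitz_on_balls_def
proof
  fix r
  obtain K where K: "0 \<le> K" "\<And>a b. norm (h a b) \<le> norm a * norm b * K"
    using bounded_bilinear.nonneg_bounded[OF h] by blast
  obtain L M where L: "L-lipschitz_on (cball 0 r) f" and M: "M-lipschitz_on (cball 0 r) g"
    using f g unfolding lipschitz_on_balls_def by blast
  obtain P where P: "0 \<le> P" "\<And>x. norm x \<le> r \<Longrightarrow> norm (f x) \<le> P"
    using lipschitz_on_balls_bounded[OF f] by blast
  obtain Q where Q: "0 \<le> Q" "\<And>x. norm x \<le> r \<Longrightarrow> norm (g x) \<le> Q"
    using lipschitz_on_balls_bounded[OF g] by blast
  have LM: "0 \<le> L" "0 \<le> M"
    using L M lipschitz_on_nonneg by auto
  have "(L * Q * K + P * M * K)-lipschitz_on (cball 0 r) (\<lambda>x. h (f x) (g x))"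
  proof (rule lipschitz_onI)
    fix x y :: 'a
    assume x: "x \<in> cball 0 r" and y: "y \<in> cball 0 r"
    have "h (f x) (g x) - h (f y) (g y) = h (f x - f y) (g x) + h (f y) (g x - g y)"
      by (simp add: bounded_bilinear.diff_left[OF h] bounded_bilinear.diff_right[OF h])
    then have "dist (h (f x) (g x)) (h (f y) (g y))
        \<le> norm (h (f x - f y) (g x)) + norm (h (f y) (g x - g y))"
      by (simp add: dist_norm norm_triangle_ineq)
    also have "\<dots> \<le> norm (f x - f y) * norm (g x) * K + norm (f y) * norm (g x - g y) * K"
      by (intro add_mono K)
    also have "\<dots> \<le> (L * dist x y) * Q * K + P * (M * dist x y) * K"
      using x y K P Q LM lipschitz_onD[OF L x y] lipschitz_onD[OF M x y]
      by (intro add_mono mult_mono mult_nonneg_nonneg) (auto simp: dist_norm)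
    finally show "dist (h (f x) (g x)) (h (f y) (g y)) \<le> (L * Q * K + P * M * K) * dist x y"
      by (simp add: algebra_simps)
  qed (use LM K P Q in simp)
  then show "\<exists>L. L-lipschitz_on (cball 0 r) (\<lambda>x. h (f x) (g x))" ..
qed

text \<open>Gronwall's argument: both solutions stay in a ball on which \<open>F\<close> is \<open>L\<close>-Lipschitz, so
  \<open>exp (-2Lt) |X - Y|\<^sup>2\<close> does not increase, and it starts at zero.\<close>

lemma ode_unique_forward:
  fixes F :: "'a::real_inner \<Rightarrow> 'a"
  assumes F: "lipschitz_on_balls F" and "0 \<le> b"
    and X: "\<And>t. t \<in> {0..b} \<Longrightarrow> (X has_vector_derivative F (X t)) (at t within {0..b})"
    and Y: "\<And>t. t \<in> {0..b} \<Longrightarrow> (Y has_vector_derivative F (Y t)) (at t within {0..b})"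
    and init: "X 0 = Y 0"
  shows "X b = Y b"
proof -
  have cX: "continuous_on {0..b} X" and cY: "continuous_on {0..b} Y"
    by (rule continuous_on_vector_derivative[OF X], assumption)
      (rule continuous_on_vector_derivative[OF Y], assumption)
  have "bounded (X ` {0..b} \<union> Y ` {0..b})"
    using cX cY by (auto intro!: compact_imp_bounded compact_continuous_image)
  then obtain r where r: "\<And>t. t \<in> {0..b} \<Longrightarrow> norm (X t) \<le> r \<and> norm (Y t) \<le> r"
    unfolding bounded_iff by blast
  obtain L where L: "L-lipschitz_on (cball 0 r) F"
    using F unfolding lipschitz_on_balls_def by blast
  define Z where "Z = (\<lambda>t. X t - Y t)"
  define h where "h = (\<lambda>t. exp (- 2 * L * t) * (Z t \<bullet> Z t))"
  have "h b \<le> h 0"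
  proof (rule DERIV_nonpos_imp_decreasing_open[OF \<open>0 \<le> b\<close>])
    show "continuous_on {0..b} h"
      unfolding h_def Z_def by (intro continuous_intros cX cY)
    fix t assume t: "0 < t" "t < b"
    define W where "W = F (X t) - F (Y t)"
    have at: "at t within {0..b} = at t"
      using t by (intro at_within_interior) simp
    have Z': "(Z has_derivative (\<lambda>s. s *\<^sub>R W)) (at t)"
      using has_vector_derivative_diff[OF X[of t] Y[of t]] t
      by (simp add: Z_def W_def at has_vector_derivative_def)
    have "(h has_derivative (\<lambda>s. s * (2 * exp (- 2 * L * t) * (Z t \<bullet> W - L * (Z t \<bullet> Z t))))) (at t)"
      unfolding h_def
      by (auto intro!: derivative_eq_intros Z' simp: fun_eq_iff algebra_simps inner_commute)
    then have "DERIV h t :> 2 * exp (- 2 * L * t) * (Z t \<bullet> W - L * (Z t \<bullet> Z t))"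
      by (rule has_derivative_imp_has_field_derivative) simp
    moreover have "Z t \<bullet> W \<le> L * (Z t \<bullet> Z t)"
    proof -
      have "Z t \<bullet> W \<le> norm (Z t) * norm W" by (rule norm_cauchy_schwarz)
      also have "\<dots> \<le> norm (Z t) * (L * norm (Z t))"
        unfolding W_def Z_def using r[of t] t
        by (intro mult_left_mono lipschitz_on_normD[OF L]) auto
      finally show ?thesis
        by (simp add: power2_norm_eq_inner[symmetric] power2_eq_square algebra_simps)
    qed
    ultimately show "\<exists>y. DERIV h t :> y \<and> y \<le> 0"
      by (intro exI conjI) (auto simp: mult_nonneg_nonpos)
  qed
  then have "exp (- 2 * L * b) * (norm (Z b))\<^sup>2 \<le> 0"
    by (simp add: h_def Z_def init power2_norm_eq_inner)
  then have "Z b = 0"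
    by (simp add: mult_le_0_iff)
  then show ?thesis
    by (simp add: Z_def)
qed

text \<open>Negative times reduce to positive ones by reversing time, which replaces \<open>F\<close> by \<open>-F\<close>.\<close>

lemma ode_unique:
  fixes F :: "'a::real_inner \<Rightarrow> 'a"
  assumes F: "lipschitz_on_balls F" and T: "is_interval T" "0 \<in> T" and "t \<in> T"
    and X: "\<And>t. t \<in> T \<Longrightarrow> (X has_vector_derivative F (X t)) (at t within T)"
    and Y: "\<And>t. t \<in> T \<Longrightarrow> (Y has_vector_derivative F (Y t)) (at t within T)"
    and init: "X 0 = Y 0"
  shows "X t = Y t"
proof (cases "0 \<le> t")
  case True
  then have "{0..t} \<subseteq> T"
    using T \<open>t \<in> T\<close> by (meson atLeastAtMost_iff mem_is_interval_1_I subsetI)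
  then have "(X has_vector_derivative F (X s)) (at s within {0..t})"
    "(Y has_vector_derivative F (Y s)) (at s within {0..t})" if "s \<in> {0..t}" for s
    using X[of s] Y[of s] that by (blast intro: has_vector_derivative_within_subset)+
  then show ?thesis
    by (rule ode_unique_forward[where F=F and X=X and Y=Y, OF F True _ _ init])
next
  case False
  have sub: "uminus ` {0..-t} \<subseteq> T"
    using mem_is_interval_1_I[OF T(1) \<open>t \<in> T\<close> T(2)] by auto
  have rev: "((\<lambda>s. Z (- s)) has_vector_derivative - F (Z (- s))) (at s within {0..-t})"
    if Z: "\<And>t. t \<in> T \<Longrightarrow> (Z has_vector_derivative F (Z t)) (at t within T)" and s: "s \<in> {0..-t}"
    for Z s
  proof -
    have "(Z has_vector_derivative F (Z (- s))) (at (- s) within uminus ` {0..-t})"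
      using sub s by (intro has_vector_derivative_within_subset[OF Z sub]) auto
    moreover have "(uminus has_vector_derivative (-1::real)) (at s within {0..-t})"
      by (auto intro!: derivative_eq_intros)
    ultimately show ?thesis
      using vector_diff_chain_within[of uminus "-1" s "{0..-t}" Z] by (simp add: o_def)
  qed
  have "X (- (- t)) = Y (- (- t))"
    by (rule ode_unique_forward[where F="\<lambda>x. - F x" and X="\<lambda>s. X (- s)" and Y="\<lambda>s. Y (- s)"])
      (use False in \<open>auto simp: init intro!: lipschitz_on_balls_minus[OF F] rev[of X] rev[of Y] X Y\<close>)
  then show ?thesis by simp
qed

section \<open>Homothetic solutions of the bracket flow\<close>

lemma lipschitz_on_balls_bracket_flow_rhs: "lipschitz_on_balls (bracket_flow_rhs :: real^'n^'n \<Rightarrow> _)"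
proof -
  have id: "lipschitz_on_balls (\<lambda>A :: real^'n^'n. A)"
    by (rule lipschitz_on_balls_linear) (rule bounded_linear_ident)
  have tr: "bounded_linear (transpose :: real^'n^'n \<Rightarrow> _)" "bounded_linear (trace :: real^'n^'n \<Rightarrow> _)"
    unfolding linear_conv_bounded_linear[symmetric]
    by (auto intro!: linearI simp: transpose_add transpose_scalar trace_add trace_scaleR)
  have sp: "lipschitz_on_balls (sym_part :: real^'n^'n \<Rightarrow> _)"
    unfolding sym_part_def
    by (intro lipschitz_on_balls_linear bounded_linear_intros tr bounded_linear_ident)
  have tr': "lipschitz_on_balls (\<lambda>A :: real^'n^'n. transpose A)"
    by (rule lipschitz_on_balls_linear[OF tr(1)])
  have comm: "bounded_bilinear (commutator :: real^'n^'n \<Rightarrow> _)"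
    unfolding bilinear_conv_bounded_bilinear[symmetric] bilinear_def
    by (intro conjI allI linearI) (simp_all add: commutator_scaleR,
     simp_all add: commutator_def matrix_mult_bilinear)
  have trm: "bounded_bilinear (\<lambda>A B :: real^'n^'n. trace (A ** B))"
    unfolding bilinear_conv_bounded_bilinear[symmetric] bilinear_def
    by (intro conjI allI linearI) (simp_all add: matrix_mult_bilinear trace_add trace_scaleR)
  have C: "lipschitz_on_balls (\<lambda>A :: real^'n^'n. commutator A (transpose A))"
    by (rule lipschitz_on_balls_bilinear[OF comm id tr'])
  have scale: "lipschitz_on_balls (\<lambda>A. r *\<^sub>R f A)" if "lipschitz_on_balls f"
    for r :: real and f :: "real^'n^'n \<Rightarrow> real^'n^'n"
    unfolding lipschitz_on_balls_def
  proof
    fix s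
    from that obtain L where "L-lipschitz_on (cball 0 s) f"
      unfolding lipschitz_on_balls_def by blast
    from lipschitz_on_cmult[OF this, of r] show "\<exists>L. L-lipschitz_on (cball 0 s) (\<lambda>A. r *\<^sub>R f A)"
      by blast
  qed
  have half_tr: "lipschitz_on_balls (\<lambda>A :: real^'n^'n. 1 / 2 * trace A)"
    by (intro lipschitz_on_balls_linear bounded_linear_intros tr)
  have 1: "lipschitz_on_balls (\<lambda>A :: real^'n^'n. - trace (sym_part A ** sym_part A) *\<^sub>R A)"
    by (rule lipschitz_on_balls_bilinear[OF bounded_bilinear_scaleR lipschitz_on_balls_minus[OF
        lipschitz_on_balls_bilinear[OF trm sp sp]] id])
  have 2: "lipschitz_on_balls (\<lambda>A :: real^'n^'n. (1/2) *\<^sub>R commutator A (commutator A (transpose A)))"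
    by (rule scale[OF lipschitz_on_balls_bilinear[OF comm id C]])
  have 3: "lipschitz_on_balls (\<lambda>A :: real^'n^'n. (1/2 * trace A) *\<^sub>R commutator A (transpose A))"
    by (rule lipschitz_on_balls_bilinear[OF bounded_bilinear_scaleR half_tr C])
  from lipschitz_on_balls_diff[OF lipschitz_on_balls_add[OF 1 2] 3] show ?thesis
    by (simp add: bracket_flow_rhs_def[abs_def])
qed

lemma bracket_flow_rhs_scaleR: "bracket_flow_rhs (r *\<^sub>R A) = r ^ 3 *\<^sub>R bracket_flow_rhs A"
proof -
  have "sym_part (r *\<^sub>R A) = r *\<^sub>R sym_part A"
    by (simp add: sym_part_def transpose_scalar scaleR_add_right)
  then show ?thesis
    by (simp add: bracket_flow_rhs_def commutator_scaleR matrix_mult_bilinear trace_scaleR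
        transpose_scalar scaleR_add_right scaleR_diff_right power3_eq_cube mult.commute mult.left_commute)
qed

text \<open>On multiples \<open>fA\<^sub>0\<close> the flow is \<open>f' = -(k/2) f\<^sup>3\<close>, because the field is homogeneous of degree three.\<close>

lemma homothetic_bracket_flow:
  fixes A0 :: "real^'n^'n"
  assumes rhs: "bracket_flow_rhs A0 = (- k / 2) *\<^sub>R A0"
  shows "bracket_flow_on A0 {t. k * t + 1 > 0} (\<lambda>t. (k * t + 1) powr (-1/2) *\<^sub>R A0)"
    (is "bracket_flow_on A0 ?T ?A")
proof -
  have int: "is_interval ?T"
  proof -
    have "convex ?T"
    proof -
      have "?T = (\<lambda>t. k * t) -` {-1<..}" by auto
      then show ?thesis
        by (simp add: convex_linear_vimage linear_times)
    qed
    then show ?thesis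
      by (simp add: is_interval_convex_1)
  qed
  have deriv: "(?A has_vector_derivative bracket_flow_rhs (?A t)) (at t within ?T)" if "t \<in> ?T" for t
  proof -
    let ?u = "k * t + 1"
    have u: "?u > 0" using that by simp
    have "((\<lambda>t. (k * t + 1) powr (-1/2)) has_real_derivative (- k / 2) * ?u powr (- 3 / 2)) (at t)"
      using u by (auto intro!: derivative_eq_intros)
    moreover have "?u powr (- 3 / 2) = (?u powr (-1/2)) ^ 3"
      using u by (simp add: powr_power)
    ultimately have "((\<lambda>t. (k * t + 1) powr (-1/2)) has_real_derivative
        (- k / 2) * (?u powr (-1/2)) ^ 3) (at t within ?T)"
      by (auto intro: has_field_derivative_at_within)
    from has_vector_derivative_scaleR[OF this has_vector_derivative_const, of A0]
    show ?thesis
      unfolding bracket_flow_rhs_scaleR rhs by (simp add: mult.commute)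
  qed
  have sol: "bracket_flow_solution A0 ?T ?A"
    using int deriv by (simp add: bracket_flow_solution_def)
  have uniq: "B t = ?A t" if B: "bracket_flow_solution A0 T' B" and t: "t \<in> ?T \<inter> T'" for T' B t
  proof -
    let ?J = "?T \<inter> T'"
    have J: "is_interval ?J" "0 \<in> ?J" "?A 0 = B 0"
      using int B by (simp_all add: bracket_flow_solution_def is_interval_Int)
    have dA: "(?A has_vector_derivative bracket_flow_rhs (?A s)) (at s within ?J)" if "s \<in> ?J" for s
      using that by (intro has_vector_derivative_within_subset[OF deriv[of s]]) blast+
    have dB: "(B has_vector_derivative bracket_flow_rhs (B s)) (at s within ?J)" if "s \<in> ?J" for s
    proof -
      have "(B has_vector_derivative bracket_flow_rhs (B s)) (at s within T')"
        using B that by (simp add: bracket_flow_solution_def)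
      then show ?thesis
        by (rule has_vector_derivative_within_subset) blast
    qed
    have "?A t = B t"
      by (rule ode_unique[where F=bracket_flow_rhs and X="?A" and Y=B and T="?J" and t=t,
          OF lipschitz_on_balls_bracket_flow_rhs J(1,2) t dA dB J(3)])
    then show ?thesis ..
  qed
  show ?thesis
    unfolding bracket_flow_on_def by (intro conjI allI impI ballI sol uniq)
qed

text \<open>If \<open>k = 0\<close>, the interval is the whole line. Otherwise a solution reaching beyond it would be
  continuous at \<open>-1/k\<close>, where it has to agree in the limit with the unbounded explicit solution.
  For \<open>A\<^sub>0 = 0\<close> and \<open>k \<noteq> 0\<close> the zero solution does extend beyond the interval, whence the hypothesis.\<close>

lemma maximal_homothetic_bracket_flow:
  fixes A0 :: "real^'n^'n"
  assumes rhs: "bracket_flow_rhs A0 = (- k / 2) *\<^sub>R A0" and ne: "A0 \<noteq> 0 \<or> k = 0"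
  shows "maximal_bracket_flow A0 {t. k * t + 1 > 0} (\<lambda>t. (k * t + 1) powr (-1/2) *\<^sub>R A0)"
    (is "maximal_bracket_flow A0 ?T ?A")
proof -
  note on = homothetic_bracket_flow[OF rhs]
  have "t \<in> ?T" if B: "bracket_flow_solution A0 T' B" and t: "t \<in> T'" for T' B t
  proof (rule ccontr)
    assume nt: "t \<notin> ?T"
    define \<tau> where "\<tau> = - 1 / k"
    have k: "k \<noteq> 0" using nt by auto
    have T': "is_interval T'" "0 \<in> T'"
      using B by (auto simp: bracket_flow_solution_def)
    have \<tau>: "\<theta> * \<tau> \<in> T'" if "0 \<le> \<theta>" "\<theta> \<le> 1" for \<theta>
    proof -
      have kt: "1 \<le> - k * t" using nt by (simp add: algebra_simps)
      \<comment> \<open>The point \<open>\<theta> * \<tau>\<close> lies between 0 and \<open>t\<close>, at the fraction \<open>\<kappa>\<close>.\<close>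
      define \<kappa> where "\<kappa> = \<theta> / (- k * t)"
      have "0 \<le> \<kappa>"
        unfolding \<kappa>_def using kt that by (intro divide_nonneg_pos) linarith+
      moreover have "\<kappa> \<le> 1"
        unfolding \<kappa>_def using kt that by (subst divide_le_eq_1_pos) linarith+
      ultimately have "(1 - \<kappa>) *\<^sub>R 0 + \<kappa> *\<^sub>R t \<in> T'"
        using T' t by (intro convexD) (auto simp: is_interval_convex_1)
      moreover have "\<kappa> * t = \<theta> * \<tau>"
      proof -
        have "t \<noteq> 0" using kt by auto
        then show ?thesis using k by (simp add: \<kappa>_def \<tau>_def)
      qed
      ultimately show ?thesis by simp
    qed
    \<comment> \<open>Rescaled time \<open>\<theta>\<close> runs from the start at 0 to the blow-up time \<open>\<tau>\<close> at 1. The factor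
      \<open>1 - \<theta>\<close> compensates the growth, so \<open>\<phi>\<close> is constant before time 1 and zero there.\<close>
    define \<phi> where "\<phi> = (\<lambda>\<theta>. (1 - \<theta>) * (norm (B (\<theta> * \<tau>)))\<^sup>2)"
    have "continuous_on T' B"
      by (rule continuous_on_vector_derivative[of T' B "\<lambda>t. bracket_flow_rhs (B t)"])
        (use B in \<open>simp add: bracket_flow_solution_def\<close>)
    then have "continuous_on {0..1} (\<lambda>\<theta>. B (\<theta> * \<tau>))"
      by (rule continuous_on_compose2) (auto intro!: continuous_intros \<tau>)
    then have "continuous_on {0..1} \<phi>"
      unfolding \<phi>_def by (intro continuous_intros)
    moreover have "\<phi> \<theta> = (norm A0)\<^sup>2" if "\<theta> \<in> {0..<1}" for \<theta>
    proof -
      have u: "k * (\<theta> * \<tau>) + 1 = 1 - \<theta>"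
        using k by (simp add: \<tau>_def)
      have "B (\<theta> * \<tau>) = ?A (\<theta> * \<tau>)"
      proof -
        have "\<theta> * \<tau> \<in> ?T \<inter> T'"
          using \<tau>[of \<theta>] that u by simp
        then show ?thesis
          using on B unfolding bracket_flow_on_def by blast
      qed
      moreover have "((1 - \<theta>) powr (-1/2))\<^sup>2 = 1 / (1 - \<theta>)"
      proof -
        have "((1 - \<theta>) powr (-1/2))\<^sup>2 = (1 - \<theta>) powr (-1)"
          using that by (subst powr_power) auto
        then show ?thesis
          using that by (simp add: powr_minus_divide)
      qed
      ultimately show ?thesis
        using that u by (simp add: \<phi>_def power_mult_distrib)
    qed
    ultimately have "\<phi> 1 = (norm A0)\<^sup>2"
      using continuous_constant_on_closure[of "{0..<1::real}" \<phi> "(norm A0)\<^sup>2" 1] by simp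
    then show False
      using ne k by (simp add: \<phi>_def)
  qed
  then show ?thesis
    unfolding maximal_bracket_flow_def by (intro conjI allI impI subsetI on)
qed

theorem proposition3p3:
  fixes A0 :: "real^'n^'n"
  shows "(algebraic_soliton A0 \<longleftrightarrow>
           normal_matrix A0 \<or>
           (nilpotent_matrix A0 \<and>
            (\<exists>c. commutator A0 (commutator A0 (transpose A0)) = c *\<^sub>R A0))) \<and>
         (normal_matrix A0 \<longrightarrow>
           maximal_bracket_flow A0
             {t. 2 * trace (sym_part A0 ** sym_part A0) * t + 1 > 0}
             (\<lambda>t. (2 * trace (sym_part A0 ** sym_part A0) * t + 1) powr (-1/2) *\<^sub>R A0)) \<and>
         (\<forall>c. nilpotent_matrix A0 \<and>
              commutator A0 (commutator A0 (transpose A0)) = c *\<^sub>R A0 \<longrightarrow>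
           bracket_flow_on A0
             {t. (trace (A0 ** transpose A0) - c) * t + 1 > 0}
             (\<lambda>t. ((trace (A0 ** transpose A0) - c) * t + 1) powr (-1/2) *\<^sub>R A0) \<and>
           (A0 \<noteq> 0 \<longrightarrow>
             maximal_bracket_flow A0
               {t. (trace (A0 ** transpose A0) - c) * t + 1 > 0}
               (\<lambda>t. ((trace (A0 ** transpose A0) - c) * t + 1) powr (-1/2) *\<^sub>R A0)))"
proof (intro conjI allI impI)
  show "algebraic_soliton A0 \<longleftrightarrow> normal_matrix A0 \<or>
      (nilpotent_matrix A0 \<and> (\<exists>c. commutator A0 (commutator A0 (transpose A0)) = c *\<^sub>R A0))"
    unfolding algebraic_soliton_iff by (rule soliton_equation_iff)
next
  let ?k = "2 * trace (sym_part A0 ** sym_part A0)"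
  assume "normal_matrix A0"
  then have "bracket_flow_rhs A0 = (- ?k / 2) *\<^sub>R A0"
    by (simp add: bracket_flow_rhs_def normal_iff_commutator)
  moreover have "A0 \<noteq> 0 \<or> ?k = 0"
  proof -
    have "sym_part 0 = (0 :: real^'n^'n)"
      by (simp add: sym_part_def transpose_def vec_eq_iff)
    then show ?thesis
      by (auto simp: trace_def)
  qed
  ultimately show "maximal_bracket_flow A0 {t. ?k * t + 1 > 0} (\<lambda>t. (?k * t + 1) powr (-1/2) *\<^sub>R A0)"
    by (rule maximal_homothetic_bracket_flow)
next
  fix c
  let ?k = "trace (A0 ** transpose A0) - c"
  assume "nilpotent_matrix A0 \<and> commutator A0 (commutator A0 (transpose A0)) = c *\<^sub>R A0"
  then have nil: "nilpotent_matrix A0" and eq: "commutator A0 (commutator A0 (transpose A0)) = c *\<^sub>R A0"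
    by auto
  \<comment> \<open>With \<open>tr A\<^sub>0 = tr (A\<^sub>0\<^sup>2) = 0\<close> the first coefficient of the field is \<open>-tr (S\<^sup>2) = -|A\<^sub>0|\<^sup>2/2\<close>.\<close>
  have rhs: "bracket_flow_rhs A0 = (- ?k / 2) *\<^sub>R A0"
    by (simp add: bracket_flow_rhs_def eq trace_sym_part_sq nilpotent_soliton_traces[OF nil eq]
        diff_divide_distrib scaleR_diff_left)
  then show "bracket_flow_on A0 {t. ?k * t + 1 > 0} (\<lambda>t. (?k * t + 1) powr (-1/2) *\<^sub>R A0)"
    by (rule homothetic_bracket_flow)
  assume "A0 \<noteq> 0"
  with rhs show "maximal_bracket_flow A0 {t. ?k * t + 1 > 0} (\<lambda>t. (?k * t + 1) powr (-1/2) *\<^sub>R A0)"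
    by (intro maximal_homothetic_bracket_flow) auto
qed

end
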